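(* Let $\nu$ be a probability measure on $\mathbb{R}^d$ satisfying a logarithmic Sobolev inequality with constant $C_{\mathsf{LSI}}(\nu)<\infty$. Let $\nu_t=\nu*\gamma_t$ for $t\ge0$, and for $p\in(1,\infty)$ define $q:[0,\infty)\to(1,\infty)$ by $$\frac{q(t)-1}{p-1}=1+\frac{t}{C_{\mathsf{LSI}}(\nu)}.$$ Then the $L^2(\nu)$-adjoint $Q_t$ of the heat semigroup satisfies $$\|Q_tf\|_{L^{q(t)}(\nu_t)}\le\|f\|_{L^p(\nu)}\qquad\text{for all }p\in(1,\infty),\ t\ge0,\ \text{and } f\in L^p(\nu).$$
   Context: $\gamma_t$ is the centered Gaussian on $\mathbb{R}^d$ with covariance $tI_d$ ($\nu*\gamma_0=\nu$). The measure $\nu$ satisfies a logarithmic Sobolev inequality with constant $C$ if for every locally Lipschitz $f\in L^2(\nu)$, $\int f^2\log f^2\,d\nu-\int f^2\,d\nu\cdot\log\int f^2\,d\nu\le 2C\int|\nabla f|^2\,d\nu$; $C_{\mathsf{LSI}}(\nu)$ is the smallest such $C$. The heat semigroup is $P_tf=f*\gamma_t$, viewed as an operator from $L^2(\nu_t)$ to $L^2(\nu)$; its adjoint $Q_t$ (from $L^2(\nu)$ to $L^2(\nu_t)$) is given by $Q_0=\mathrm{id}$ and $Q_tf=\frac{P_t(f\nu)}{P_t\nu}=\frac{(f\nu)*\gamma_t}{\nu*\gamma_t}$ for $t>0$. Equivalently, $Q_tf(y)=\mathbb{E}[f(Z_0)\mid Z_t=y]$, where $Z_0\sim\nu$ and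 $Z_t=Z_0+\sqrt t\,G$ with $G$ an independent standard Gaussian. *)

theory Defs
  imports "HOL-Probability.Probability"
begin

definition locally_lipschitz :: "('a::metric_space \<Rightarrow> 'b::metric_space) \<Rightarrow> bool" where
  "locally_lipschitz f \<longleftrightarrow> (\<forall>x. \<exists>r>0. \<exists>L. L-lipschitz_on (cball x r) f)"

(* The norm of the gradient. A locally Lipschitz function is differentiable Lebesgue-almost
   everywhere, but the measure integrated against may be singular. At points of
   non-differentiability the usual pointwise Lipschitz constant is used, which agrees with
   the norm of the gradient where the latter exists. *)
definition grad_norm :: "('a::euclidean_space \<Rightarrow> real) \<Rightarrow> 'a \<Rightarrow> real" where
  "grad_norm f x =
    (if \<exists>D. GDERIV f x :> D then norm (THE D. GDERIV f x :> D)
     else real_of_ereal (Limsup (at x) (\<lambda>y. ereal (\<bar>f y - f x\<bar> / dist y x))))"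

(* If the Dirichlet energy is infinite, the inequality holds trivially. If it is finite, the
   entropy has to be finite as well; since f^2 ln f^2 is bounded below, this means
   integrability. The convention ln 0 = 0 of the library gives 0 ln 0 = 0 here. *)
definition log_sobolev :: "'a::euclidean_space measure \<Rightarrow> real \<Rightarrow> bool" where
  "log_sobolev \<nu> C \<longleftrightarrow>
    (\<forall>f. locally_lipschitz f \<longrightarrow> integrable \<nu> (\<lambda>x. (f x)\<^sup>2) \<longrightarrow>
      integrable \<nu> (\<lambda>x. (grad_norm f x)\<^sup>2) \<longrightarrow>
      integrable \<nu> (\<lambda>x. (f x)\<^sup>2 * ln ((f x)\<^sup>2)) \<and>
      (\<integral>x. (f x)\<^sup>2 * ln ((f x)\<^sup>2) \<partial>\<nu>) - (\<integral>x. (f x)\<^sup>2 \<partial>\<nu>) * ln (\<integral>x. (f x)\<^sup>2 \<partial>\<nu>)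
        \<le> 2 * C * (\<integral>x. (grad_norm f x)\<^sup>2 \<partial>\<nu>))"

definition C_LSI :: "'a::euclidean_space measure \<Rightarrow> real" where
  "C_LSI \<nu> = Inf {C. log_sobolev \<nu> C}"

definition gauss_density :: "real \<Rightarrow> real ^ 'n \<Rightarrow> real" where
  "gauss_density t x = (2 * pi * t) powr (- real CARD('n) / 2) * exp (- (norm x)\<^sup>2 / (2 * t))"

definition gauss :: "real \<Rightarrow> (real ^ 'n) measure" where
  "gauss t = (if t = 0 then return borel 0 else density lborel (\<lambda>x. ennreal (gauss_density t x)))"

(* For t > 0 this is the quotient of the Lebesgue densities of the (signed) measure
   (f nu) * gamma_t and of nu * gamma_t. *)
definition heat_adjoint :: "(real ^ 'n) measure \<Rightarrow> real \<Rightarrow> (real ^ 'n \<Rightarrow> real) \<Rightarrow> real ^ 'n \<Rightarrow> real" where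
  "heat_adjoint \<nu> t f y =
    (if t = 0 then f y
     else (\<integral>x. f x * gauss_density t (y - x) \<partial>\<nu>) / (\<integral>x. gauss_density t (y - x) \<partial>\<nu>))"

definition in_Lp :: "real \<Rightarrow> 'a measure \<Rightarrow> ('a \<Rightarrow> real) \<Rightarrow> bool" where
  "in_Lp p M f \<longleftrightarrow> f \<in> borel_measurable M \<and> integrable M (\<lambda>x. \<bar>f x\<bar> powr p)"

definition Lp_norm :: "real \<Rightarrow> 'a measure \<Rightarrow> ('a \<Rightarrow> real) \<Rightarrow> real" where
  "Lp_norm p M f = (\<integral>x. \<bar>f x\<bar> powr p \<partial>M) powr (1 / p)"

end

theory Submission
  imports Defs
begin

text \<open>
  By duality the claim is a hypercontractive estimate for the heat semigroup itself.
  Write \<open>C\<close> for the optimal constant, \<open>\<kappa> = t / C\<close>, and let \<open>a\<close> and \<open>b\<close> be the exponents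
  conjugate to \<open>p\<close> and \<open>q(t)\<close>. The relation between \<open>p\<close> and \<open>q(t)\<close> becomes
  \<open>a = b + (b - 1) \<kappa>\<close>, and what has to be shown is that \<open>P_t\<close> maps \<open>L^b(\<nu>_t)\<close> into
  \<open>L^a(\<nu>)\<close> with norm at most one.

  For a function \<open>g\<close> bounded above and away from zero, let
  \<open>u_r = (1/r) ln P_t(g^r)\<close> for \<open>1 \<le> r \<le> b\<close>. This family joins the two sides of the
  estimate: \<open>exp u_1 = P_t g\<close>, while \<open>exp (b u_b) = P_t(g^b)\<close> has \<open>\<nu>\<close>-integral
  \<open>\<integral> g^b d\<nu>_t\<close>. Two facts make it work.

  \<^item> The family satisfies \<open>(t/2) |\<nabla>u_r|^2 \<le> \<partial>_r u_r\<close>. At a point \<open>x\<close>, both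
    sides are read off the Gaussian measure centred at \<open>x\<close>, reweighted by \<open>g^r\<close> and normalised:
    \<open>r^2 \<partial>_r u_r\<close> is its relative entropy and \<open>r t \<nabla>u_r\<close> is the displacement of its mean.
    The variational formula for the entropy, tested against affine functions, bounds the square
    of the second by the first (\<open>reverse_log_sobolev\<close>).
    Integrated along a line segment traversed as \<open>r\<close> varies, it gives Wang's Harnack inequality
    for the heat semigroup.

  \<^item> Along any family with that property, the norm of \<open>exp u_r\<close> in \<open>L^\<lambda>(\<nu>)\<close>, with exponent
    \<open>\<lambda> = b + (b - r) \<kappa>\<close>, is nondecreasing in \<open>r\<close>. Its derivative consists of an entropy
    term with coefficient \<open>- \<kappa>\<close> and of the integral of \<open>\<partial>_r u_r\<close>; the logarithmic Sobolev
    inequality for \<open>exp (\<lambda> u_r / 2)\<close> says that the second outweighs the first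
    (\<open>hamilton_jacobi_hypercontractive\<close>). This is the argument of Bobkov, Gentil and Ledoux for
    the Hamilton-Jacobi equation, with \<open>(b - r) t\<close> as time.

  Comparing \<open>r = 1\<close> with \<open>r = b\<close> gives the estimate for \<open>P_t\<close> (\<open>heat_hypercontractive\<close>). Testing
  \<open>Q_t |f|\<close> against \<open>min (Q_t |f|) n ^ (q - 1)\<close>, moving \<open>Q_t\<close> to the other side as \<open>P_t\<close>, and
  letting \<open>n\<close> tend to infinity yields the theorem.
\<close>

section \<open>Gaussian measures\<close>

lemma gauss_density_prod:
  fixes x :: "real ^ 'n"
  assumes "0 < t"
  shows "gauss_density t x = (\<Prod>b\<in>Basis. normal_density 0 (sqrt t) (x \<bullet> b))"
proof -
  have "(\<Prod>b\<in>(Basis :: (real ^ 'n) set). normal_density 0 (sqrt t) (x \<bullet> b)) =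
      (1 / sqrt (2 * pi * t)) ^ CARD('n) * exp (\<Sum>b\<in>Basis. - (x \<bullet> b)\<^sup>2 / (2 * t))"
    using assms by (simp add: normal_density_def prod.distrib exp_sum power_divide prod_dividef)
  moreover have "(\<Sum>b\<in>Basis. - (x \<bullet> b)\<^sup>2 / (2 * t)) = - (norm x)\<^sup>2 / (2 * t)"
    unfolding power2_norm_eq_inner
    by (subst (2) euclidean_inner) (simp add: sum_negf sum_divide_distrib power2_eq_square)
  moreover have "(2 * pi * t) powr (- real CARD('n) / 2) = (1 / sqrt (2 * pi * t)) ^ CARD('n)"
    using assms by (simp add: powr_minus_divide powr_half_sqrt [symmetric] powr_powr
        powr_realpow [symmetric] power_one_over)
  ultimately show ?thesis
    by (simp add: gauss_density_def)
qed

lemma gauss_density_nonneg [simp]: "0 \<le> gauss_density t x"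
  by (simp add: gauss_density_def)

lemma gauss_density_pos: "0 < t \<Longrightarrow> 0 < gauss_density t x"
  by (simp add: gauss_density_def)

lemma gauss_density_measurable [measurable]: "gauss_density t \<in> borel_measurable borel"
  by (simp add: gauss_density_def [abs_def])

lemma gauss_density_le: "0 < t \<Longrightarrow> gauss_density t (x :: real ^ 'n) \<le> gauss_density t (0 :: real ^ 'n)"
  by (simp add: gauss_density_def mult_left_le)

lemma nn_integral_gauss_density:
  assumes "0 < t"
  shows "(\<integral>\<^sup>+x. gauss_density t (x :: real ^ 'n) \<partial>lborel) = 1"
proof -
  have "(\<integral>\<^sup>+x. ennreal (gauss_density t (x :: real ^ 'n)) \<partial>lborel)
      = (\<integral>\<^sup>+x. (\<Prod>b\<in>Basis. ennreal (normal_density 0 (sqrt t) ((x :: real ^ 'n) \<bullet> b))) \<partial>lborel)"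
    using assms by (simp add: gauss_density_prod prod_ennreal)
  also have "\<dots> = (\<Prod>b\<in>(Basis :: (real ^ 'n) set). \<integral>\<^sup>+x. ennreal (normal_density 0 (sqrt t) x) \<partial>lborel)"
    by (rule nn_integral_lborel_prod) auto
  also have "\<dots> = 1"
    using assms by (simp add: nn_integral_eq_integral)
  finally show ?thesis .
qed

lemma nn_integral_lborel_shift:
  fixes f :: "'a :: euclidean_space \<Rightarrow> ennreal"
  assumes [measurable]: "f \<in> borel_measurable borel"
  shows "(\<integral>\<^sup>+z. f (c + z) \<partial>lborel) = (\<integral>\<^sup>+z. f z \<partial>lborel)"
  by (subst (2) lborel_distr_plus [of c, symmetric]) (simp add: nn_integral_distr)

definition gauss_at :: "real \<Rightarrow> real ^ 'n \<Rightarrow> (real ^ 'n) measure" where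
  "gauss_at t x = density lborel (\<lambda>z. ennreal (gauss_density t (z - x)))"

lemma sets_gauss_at [simp, measurable_cong]: "sets (gauss_at t x) = sets borel"
  by (simp add: gauss_at_def)

lemma space_gauss_at [simp]: "space (gauss_at t x) = UNIV"
  by (simp add: gauss_at_def)

lemma prob_space_gauss_at:
  assumes "0 < t"
  shows "prob_space (gauss_at t x)"
proof
  have "emeasure (gauss_at t x) (space (gauss_at t x)) = (\<integral>\<^sup>+z. gauss_density t (z - x) \<partial>lborel)"
    by (simp add: gauss_at_def emeasure_density)
  also have "\<dots> = (\<integral>\<^sup>+z. gauss_density t (x + z - x) \<partial>lborel)"
    by (rule nn_integral_lborel_shift [symmetric]) simp
  also have "\<dots> = 1"
    using nn_integral_gauss_density [OF assms] by simp
  finally show "emeasure (gauss_at t x) (space (gauss_at t x)) = 1" .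
qed

lemma integral_gauss_at:
  fixes f :: "real ^ 'n \<Rightarrow> 'b :: {banach, second_countable_topology}"
  assumes "f \<in> borel_measurable borel"
  shows "(\<integral>z. f z \<partial>gauss_at t x) = (\<integral>z. gauss_density t (z - x) *\<^sub>R f z \<partial>lborel)"
  using assms unfolding gauss_at_def by (intro integral_density) auto

text \<open>
  Moving the centre of a Gaussian is the same as multiplying its density by an exponential of
  a linear function. This turns derivatives in the centre into derivatives of a Laplace
  transform, and it evaluates the exponential moments of the Gaussian.
\<close>
lemma gauss_density_tilt:
  assumes "0 < t"
  shows "gauss_density t (z - (x + h)) =
    gauss_density t (z - x) * (exp (h \<bullet> ((z - x) /\<^sub>R t)) * exp (- (norm h)\<^sup>2 / (2 * t)))"
proof -
  have "(norm (z - (x + h)))\<^sup>2 = (norm (z - x))\<^sup>2 - 2 * (h \<bullet> (z - x)) + (norm h)\<^sup>2"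
    unfolding power2_norm_eq_inner by (simp add: inner_simps inner_commute algebra_simps)
  then have "- (norm (z - (x + h)))\<^sup>2 / (2 * t) =
      - (norm (z - x))\<^sup>2 / (2 * t) + (h \<bullet> ((z - x) /\<^sub>R t) + - (norm h)\<^sup>2 / (2 * t))"
  proof -
    have alg: "- (a - 2 * b + c) / (2 * t) = - a / (2 * t) + (b / t + - c / (2 * t))" for a b c :: real
      using assms by (simp add: field_simps)
    have "h \<bullet> ((z - x) /\<^sub>R t) = (h \<bullet> (z - x)) / t"
      by (simp only: inner_scaleR_right divide_inverse_commute)
    then show ?thesis
      using \<open>(norm (z - (x + h)))\<^sup>2 = _\<close> alg by metis
  qed
  then show ?thesis
    unfolding gauss_density_def by (simp only: exp_add mult.assoc)
qed

lemma integral_gauss_at_tilt: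
  fixes f :: "real ^ 'n \<Rightarrow> real"
  assumes "0 < t" and [measurable]: "f \<in> borel_measurable borel"
  shows "(\<integral>z. f z \<partial>gauss_at t (x + h)) =
    exp (- (norm h)\<^sup>2 / (2 * t)) * (\<integral>z. f z * exp (h \<bullet> ((z - x) /\<^sub>R t)) \<partial>gauss_at t x)"
proof -
  have "(\<integral>z. f z \<partial>gauss_at t (x + h)) = (\<integral>z. gauss_density t (z - (x + h)) * f z \<partial>lborel)"
    by (simp add: integral_gauss_at)
  also have "\<dots> = (\<integral>z. exp (- (norm h)\<^sup>2 / (2 * t)) *
      (gauss_density t (z - x) * (f z * exp (h \<bullet> ((z - x) /\<^sub>R t)))) \<partial>lborel)"
    unfolding gauss_density_tilt [OF assms(1)]
    by (intro Bochner_Integration.integral_cong) (auto simp only: mult_ac)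
  also have "\<dots> = exp (- (norm h)\<^sup>2 / (2 * t)) * (\<integral>z. f z * exp (h \<bullet> ((z - x) /\<^sub>R t)) \<partial>gauss_at t x)"
    by (subst integral_gauss_at) auto
  finally show ?thesis .
qed

text \<open>
  Completing the square bounds \<open>c |w| - |w|^2 / (2 t)\<close> by \<open>c^2 t - |w|^2 / (4 t)\<close>, so that the
  integrand is dominated by a multiple of the Gaussian density of variance \<open>2 t\<close>.
\<close>
lemma integrable_gauss_at_exp_norm:
  assumes "0 < t"
  shows "integrable (gauss_at t x) (\<lambda>z. exp (c * norm (z - x)))"
proof -
  interpret N: prob_space "gauss_at (2 * t) x"
    using assms by (intro prob_space_gauss_at) simp
  define K where "K = (2 * pi * t) powr (- real CARD('a) / 2) / (2 * pi * (2 * t)) powr (- real CARD('a) / 2)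
    * exp (c\<^sup>2 * t)"
  have K: "0 \<le> K" by (simp add: K_def)
  have bd: "gauss_density t w * exp (c * norm w) \<le> K * gauss_density (2 * t) w" for w :: "real ^ 'a"
  proof -
    have "0 \<le> (norm w - 2 * c * t)\<^sup>2 / (4 * t)"
      using assms by simp
    also have "\<dots> = (norm w)\<^sup>2 / (4 * t) - c * norm w + c\<^sup>2 * t"
      using assms by (simp add: power2_eq_square field_simps)
    moreover have "(norm w)\<^sup>2 / (2 * t) = (norm w)\<^sup>2 / (4 * t) + (norm w)\<^sup>2 / (4 * t)"
      by simp
    ultimately have "- (norm w)\<^sup>2 / (2 * t) + c * norm w \<le> c\<^sup>2 * t + - (norm w)\<^sup>2 / (2 * (2 * t))"
      by simp
    then have "exp (- (norm w)\<^sup>2 / (2 * t)) * exp (c * norm w) \<le>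
        exp (c\<^sup>2 * t) * exp (- (norm w)\<^sup>2 / (2 * (2 * t)))"
      by (simp flip: exp_add)
    then show ?thesis
      using assms by (simp add: gauss_density_def K_def mult_ac)
  qed
  have "integrable lborel (\<lambda>z. gauss_density (2 * t) (z - x) *\<^sub>R (1::real))"
    using N.integrable_const [of "1::real"] unfolding gauss_at_def
    by (subst (asm) integrable_density) auto
  then have "integrable lborel (\<lambda>z. K * gauss_density (2 * t) (z - x))"
    by simp
  then have "integrable lborel (\<lambda>z. gauss_density t (z - x) *\<^sub>R exp (c * norm (z - x)))"
    by (rule Bochner_Integration.integrable_bound) (use bd K in \<open>auto simp: abs_mult\<close>)
  then show ?thesis
    unfolding gauss_at_def by (subst integrable_density) auto
qed

lemma borel_measurable_integral_gauss_at [measurable]: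
  fixes f :: "real ^ 'n \<Rightarrow> real ^ 'n \<Rightarrow> 'b :: {banach, second_countable_topology}"
  assumes [measurable]: "(\<lambda>(x, z). f x z) \<in> borel_measurable (borel \<Otimes>\<^sub>M borel)"
  shows "(\<lambda>x. \<integral>z. f x z \<partial>gauss_at t x) \<in> borel_measurable borel"
proof -
  have "(\<lambda>x. \<integral>z. gauss_density t (z - x) *\<^sub>R f x z \<partial>lborel) \<in> borel_measurable borel"
    by measurable
  then show ?thesis
    by (subst integral_gauss_at) auto
qed

lemma nn_integral_convolution_gauss:
  fixes h :: "real ^ 'n \<Rightarrow> ennreal"
  assumes "prob_space \<nu>" "sets \<nu> = sets borel" "0 < t"
    and [measurable]: "h \<in> borel_measurable borel"
  shows "(\<integral>\<^sup>+y. h y \<partial>(\<nu> \<star> gauss t)) = (\<integral>\<^sup>+x. \<integral>\<^sup>+z. h z \<partial>gauss_at t x \<partial>\<nu>)"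
proof -
  interpret \<nu>: prob_space \<nu> by fact
  interpret N: prob_space "gauss_at t (0 :: real ^ 'n)" by (rule prob_space_gauss_at [OF assms(3)])
  have g: "gauss t = gauss_at t (0 :: real ^ 'n)"
    using assms(3) by (simp add: gauss_def gauss_at_def)
  have "(\<integral>\<^sup>+y. h y \<partial>(\<nu> \<star> gauss t)) = (\<integral>\<^sup>+x. \<integral>\<^sup>+y. h (x + y) \<partial>gauss_at t 0 \<partial>\<nu>)"
    unfolding g using assms(2)
    by (intro nn_integral_convolution) (auto intro: \<nu>.finite_measure_axioms N.finite_measure_axioms)
  also have "\<dots> = (\<integral>\<^sup>+x. \<integral>\<^sup>+z. h z \<partial>gauss_at t x \<partial>\<nu>)"
  proof (rule nn_integral_cong)
    fix x
    have "(\<integral>\<^sup>+y. h (x + y) \<partial>gauss_at t 0) = (\<integral>\<^sup>+y. gauss_density t ((x + y) - x) * h (x + y) \<partial>lborel)"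
      by (simp add: gauss_at_def nn_integral_density)
    also have "\<dots> = (\<integral>\<^sup>+z. gauss_density t (z - x) * h z \<partial>lborel)"
      by (rule nn_integral_lborel_shift) measurable
    also have "\<dots> = (\<integral>\<^sup>+z. h z \<partial>gauss_at t x)"
      by (simp add: gauss_at_def nn_integral_density)
    finally show "(\<integral>\<^sup>+y. h (x + y) \<partial>gauss_at t 0) = (\<integral>\<^sup>+z. h z \<partial>gauss_at t x)" .
  qed
  finally show ?thesis .
qed

section \<open>Differentiation under the integral\<close>

lemma exp_remainder_le: "\<bar>exp a - 1 - a\<bar> \<le> a\<^sup>2 * exp \<bar>a\<bar>" for a :: real
proof -
  obtain s where s: "\<bar>s\<bar> \<le> \<bar>a\<bar>" "exp a = (\<Sum>m<2. a ^ m / fact m) + exp s / fact 2 * a ^ 2"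
    using Maclaurin_exp_le [of a 2] by blast
  then have "\<bar>exp a - 1 - a\<bar> = exp s / 2 * a\<^sup>2"
    by (simp add: numeral_2_eq_2)
  also have "\<dots> \<le> exp \<bar>a\<bar> * a\<^sup>2"
  proof (rule mult_right_mono)
    have "exp s \<le> exp \<bar>a\<bar>" using s(1) by simp
    then show "exp s / 2 \<le> exp \<bar>a\<bar>" using exp_ge_zero [of "\<bar>a\<bar>"] by linarith
  qed simp
  finally show ?thesis by (simp add: mult.commute)
qed

lemma square_le_exp: "s\<^sup>2 \<le> 2 * exp s" if "0 \<le> s" for s :: real
proof -
  have "1 + s + s\<^sup>2 / 2 \<le> exp s"
    using exp_lower_Taylor_quadratic [OF that] .
  then show ?thesis using that by simp
qed

text \<open>
  The Laplace transform of \<open>T\<close> has a Frechet derivative at the origin because the remainder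
  \<open>exp (h \<bullet> T) - 1 - h \<bullet> T\<close> is at most \<open>2 |h|^2 exp (2 |T|)\<close> for \<open>|h| \<le> 1\<close>. It is used with
  \<open>T\<close> real-valued for the derivative in the exponent of a power, and with \<open>T\<close> affine for the
  gradient of the heat semigroup.
\<close>
lemma GDERIV_exp_integral:
  fixes T :: "'a \<Rightarrow> 'b :: euclidean_space" and G :: "'a \<Rightarrow> real"
  assumes [measurable]: "T \<in> borel_measurable M" "G \<in> borel_measurable M"
    and int: "integrable M (\<lambda>z. G z * exp (2 * norm (T z)))"
  shows "GDERIV (\<lambda>h. \<integral>z. G z * exp (h \<bullet> T z) \<partial>M) 0 :> (\<integral>z. G z *\<^sub>R T z \<partial>M)"
proof -
  define K where "K = (\<integral>z. \<bar>G z * exp (2 * norm (T z))\<bar> \<partial>M)"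
  have K0: "0 \<le> K" by (simp add: K_def)
  have intT: "integrable M (\<lambda>z. G z *\<^sub>R T z)"
  proof (rule Bochner_Integration.integrable_bound [OF int])
    have "norm (T z) \<le> exp (2 * norm (T z))" for z
      using exp_ge_add_one_self [of "2 * norm (T z)"] norm_ge_zero [of "T z"] by linarith
    then show "AE z in M. norm (G z *\<^sub>R T z) \<le> norm (G z * exp (2 * norm (T z)))"
      by (auto simp: abs_mult intro!: mult_left_mono)
  qed auto
  have bound: "\<bar>(\<integral>z. G z * exp (h \<bullet> T z) \<partial>M) - (\<integral>z. G z \<partial>M) - h \<bullet> (\<integral>z. G z *\<^sub>R T z \<partial>M)\<bar>
      \<le> 2 * K * (norm h)\<^sup>2" if h: "norm h \<le> 1" for h
  proof -
    have hT: "\<bar>h \<bullet> T z\<bar> \<le> norm h * norm (T z)" for z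
      by (rule Cauchy_Schwarz_ineq2)
    have hT1: "norm h * norm (T z) \<le> norm (T z)" for z
      using h by (simp add: mult_left_le_one_le)
    have i1: "integrable M (\<lambda>z. G z * exp (h \<bullet> T z))"
    proof (rule Bochner_Integration.integrable_bound [OF int])
      have "h \<bullet> T z \<le> 2 * norm (T z)" for z
        using hT [of z] hT1 [of z] norm_ge_zero [of "T z"] by linarith
      then show "AE z in M. norm (G z * exp (h \<bullet> T z)) \<le> norm (G z * exp (2 * norm (T z)))"
        by (auto simp: abs_mult intro!: mult_left_mono)
    qed auto
    have i0: "integrable M G"
      by (rule Bochner_Integration.integrable_bound [OF int]) (auto simp: abs_mult mult_le_cancel_left1)
    have i2: "integrable M (\<lambda>z. G z * (h \<bullet> T z))"
      using integrable_inner_right [of h, OF intT] by simp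
    have eq: "(\<integral>z. G z * exp (h \<bullet> T z) \<partial>M) - (\<integral>z. G z \<partial>M) - h \<bullet> (\<integral>z. G z *\<^sub>R T z \<partial>M)
        = (\<integral>z. G z * (exp (h \<bullet> T z) - 1 - h \<bullet> T z) \<partial>M)"
      using i0 i1 i2 intT
      by (simp add: right_diff_distrib flip: integral_inner_right)
    have pt: "\<bar>G z * (exp (h \<bullet> T z) - 1 - h \<bullet> T z)\<bar> \<le> 2 * (norm h)\<^sup>2 * \<bar>G z * exp (2 * norm (T z))\<bar>" for z
    proof -
      have "\<bar>exp (h \<bullet> T z) - 1 - h \<bullet> T z\<bar> \<le> (h \<bullet> T z)\<^sup>2 * exp \<bar>h \<bullet> T z\<bar>"
        by (rule exp_remainder_le)
      also have "\<dots> \<le> ((norm h)\<^sup>2 * (norm (T z))\<^sup>2) * exp (norm (T z))"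
        using hT [of z] hT1 [of z] power_mono [OF hT [of z], of 2]
        by (intro mult_mono) (auto simp: power_mult_distrib)
      also have "\<dots> \<le> ((norm h)\<^sup>2 * (2 * exp (norm (T z)))) * exp (norm (T z))"
        by (intro mult_right_mono mult_left_mono square_le_exp) auto
      also have "\<dots> = 2 * (norm h)\<^sup>2 * exp (2 * norm (T z))"
        by (simp add: mult_exp_exp)
      finally show ?thesis
        by (auto simp: abs_mult mult_ac dest: mult_left_mono [of _ _ "\<bar>G z\<bar>"])
    qed
    have "\<bar>\<integral>z. G z * (exp (h \<bullet> T z) - 1 - h \<bullet> T z) \<partial>M\<bar>
        \<le> (\<integral>z. \<bar>G z * (exp (h \<bullet> T z) - 1 - h \<bullet> T z)\<bar> \<partial>M)"
      by (rule integral_abs_bound)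
    also have "\<dots> \<le> (\<integral>z. 2 * (norm h)\<^sup>2 * \<bar>G z * exp (2 * norm (T z))\<bar> \<partial>M)"
      using i0 i1 i2 int pt
      by (intro integral_mono integrable_abs integrable_mult_right)
        (auto simp: right_diff_distrib)
    also have "\<dots> = 2 * K * (norm h)\<^sup>2"
      by (simp add: K_def)
    finally show ?thesis unfolding eq .
  qed
  show ?thesis
    unfolding gderiv_def has_derivative_at'
  proof (intro conjI allI impI)
    show "bounded_linear (\<lambda>h. h \<bullet> (\<integral>z. G z *\<^sub>R T z \<partial>M))"
      by (rule bounded_linear_inner_left)
    fix e :: real assume e: "0 < e"
    \<comment> \<open>The summand \<open>1\<close> keeps the denominator positive when \<open>K = 0\<close>.\<close>
    define d where "d = min 1 (e / (2 * K + 1))"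
    have d: "0 < d" using e K0 by (simp add: d_def)
    have "norm ((\<integral>z. G z * exp (h \<bullet> T z) \<partial>M) - (\<integral>z. G z * exp (0 \<bullet> T z) \<partial>M)
        - (h - 0) \<bullet> (\<integral>z. G z *\<^sub>R T z \<partial>M)) / norm (h - 0) < e"
      if h: "0 < norm (h - 0)" "norm (h - 0) < d" for h
    proof -
      have h1: "norm h \<le> 1" "norm h * (2 * K + 1) < e" "0 < norm h"
        using h K0 by (auto simp: d_def field_simps)
      have "2 * K * (norm h)\<^sup>2 < e * norm h"
      proof -
        have "2 * K * (norm h)\<^sup>2 < norm h * (2 * K + 1) * norm h"
          using h1(3) by (simp add: power2_eq_square algebra_simps)
        also have "\<dots> < e * norm h"
          using h1 by (intro mult_strict_right_mono)
        finally show ?thesis .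
      qed
      with bound [OF h1(1)] h1(3) show ?thesis
        by (simp add: divide_less_eq)
    qed
    then show "\<exists>d>0. \<forall>x'. 0 < norm (x' - 0) \<and> norm (x' - 0) < d \<longrightarrow>
        norm ((\<integral>z. G z * exp (x' \<bullet> T z) \<partial>M) - (\<integral>z. G z * exp (0 \<bullet> T z) \<partial>M)
          - (x' - 0) \<bullet> (\<integral>z. G z *\<^sub>R T z \<partial>M)) / norm (x' - 0) < e"
      using d by blast
  qed
qed

text \<open>
  Difference quotients are bounded by \<open>K\<close> through the mean value theorem, so dominated
  convergence applies along every sequence of increments.
\<close>
lemma has_real_derivative_integral:
  fixes f f' :: "real \<Rightarrow> 'a \<Rightarrow> real"
  assumes "finite_measure M" and r: "r \<in> {l<..<m}"
    and der: "\<And>s x. s \<in> {l<..<m} \<Longrightarrow> ((\<lambda>s. f s x) has_real_derivative f' s x) (at s)"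
    and bd: "\<And>s x. s \<in> {l<..<m} \<Longrightarrow> \<bar>f' s x\<bar> \<le> K"
    and int: "\<And>s. s \<in> {l<..<m} \<Longrightarrow> integrable M (f s)"
    and [measurable]: "f' r \<in> borel_measurable M"
  shows "((\<lambda>s. \<integral>x. f s x \<partial>M) has_real_derivative (\<integral>x. f' r x \<partial>M)) (at r)"
proof -
  interpret finite_measure M by fact
  have "((\<lambda>s. ((\<integral>x. f s x \<partial>M) - (\<integral>x. f r x \<partial>M)) / (s - r)) \<longlongrightarrow> (\<integral>x. f' r x \<partial>M)) (at r within {l<..<m})"
    unfolding tendsto_at_iff_sequentially
  proof (intro allI impI)
    fix X :: "nat \<Rightarrow> real"
    assume X: "\<forall>i. X i \<in> {l<..<m} - {r}" and lim: "X \<longlonglongrightarrow> r"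
    have [measurable]: "f (X i) \<in> borel_measurable M" "f r \<in> borel_measurable M" for i
      using X r int by (blast intro: borel_measurable_integrable)+
    have "(\<lambda>i. \<integral>x. (f (X i) x - f r x) / (X i - r) \<partial>M) \<longlonglongrightarrow> (\<integral>x. f' r x \<partial>M)"
    proof (rule integral_dominated_convergence [where w = "\<lambda>_. K"])
      have "(\<lambda>i. (f (X i) x - f r x) / (X i - r)) \<longlonglongrightarrow> f' r x" for x
      proof -
        have "((\<lambda>s. (f s x - f r x) / (s - r)) \<longlongrightarrow> f' r x) (at r)"
          using der [OF r] by (simp add: has_field_derivative_iff)
        moreover have "filterlim X (at r) sequentially"
          using X lim by (auto simp: filterlim_at)
        ultimately show ?thesis
          by (rule filterlim_compose)
      qed
      then show "AE x in M. (\<lambda>i. (f (X i) x - f r x) / (X i - r)) \<longlonglongrightarrow> f' r x"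
        by simp
      have "\<bar>(f (X i) x - f r x) / (X i - r)\<bar> \<le> K" for i x
      proof -
        have "norm (f (X i) x - f r x) \<le> K * norm (X i - r)"
          by (rule field_differentiable_bound [where S = "{l<..<m}" and f' = "\<lambda>s. f' s x"])
            (use der bd X r in \<open>auto intro: has_field_derivative_at_within\<close>)
        then show ?thesis
          using X by (auto simp: abs_divide divide_le_eq)
      qed
      then show "AE x in M. norm ((f (X i) x - f r x) / (X i - r)) \<le> K" for i
        by simp
    qed auto
    moreover have "(\<integral>x. (f (X i) x - f r x) / (X i - r) \<partial>M) =
        ((\<integral>x. f (X i) x \<partial>M) - (\<integral>x. f r x \<partial>M)) / (X i - r)" for i
    proof -
      have "(\<integral>x. f (X i) x - f r x \<partial>M) = (\<integral>x. f (X i) x \<partial>M) - (\<integral>x. f r x \<partial>M)"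
        using X r int by (intro Bochner_Integration.integral_diff) auto
      then show ?thesis by (simp only: integral_divide_zero)
    qed
    ultimately show "((\<lambda>s. ((\<integral>x. f s x \<partial>M) - (\<integral>x. f r x \<partial>M)) / (s - r)) \<circ> X) \<longlonglongrightarrow> (\<integral>x. f' r x \<partial>M)"
      by (simp only: o_def)
  qed
  then show ?thesis
    using r by (simp add: has_field_derivative_iff at_within_open [of r "{l<..<m}"])
qed

section \<open>The logarithmic Sobolev inequality for exponentials\<close>

lemma GDERIV_unique:
  assumes "GDERIV f x :> D" "GDERIV f x :> E"
  shows "D = E"
proof -
  have "(\<lambda>h. h \<bullet> D) = (\<lambda>h. h \<bullet> E)"
    using assms unfolding gderiv_def by (rule has_derivative_unique)
  then show ?thesis
    using vector_eq_rdot [of D E] by (simp add: fun_eq_iff inner_commute)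
qed

lemma grad_norm_eq:
  assumes "GDERIV f x :> D"
  shows "grad_norm f x = norm D"
proof -
  have "(THE D. GDERIV f x :> D) = D"
    using assms by (intro the_equality) (auto intro: GDERIV_unique)
  then show ?thesis
    using assms unfolding grad_norm_def by auto
qed

lemma locally_lipschitz_bounded_gradient:
  fixes f :: "'a :: euclidean_space \<Rightarrow> real"
  assumes "\<And>x. GDERIV f x :> D x" "\<And>x. norm (D x) \<le> B"
  shows "locally_lipschitz f"
proof -
  have "B-lipschitz_on UNIV f"
  proof (rule bounded_derivative_imp_lipschitz)
    show "(f has_derivative (\<lambda>h. h \<bullet> D x)) (at x)" for x
      using assms(1) [of x] by (simp add: gderiv_def)
    show "onorm (\<lambda>h. h \<bullet> D x) \<le> B" for x
    proof (rule onorm_bound)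
      show "norm (h \<bullet> D x) \<le> B * norm h" for h
        using Cauchy_Schwarz_ineq2 [of h "D x"] mult_left_mono [OF assms(2) [of x], of "norm h"]
        by (simp add: mult.commute)
      show "0 \<le> B" using assms(2) [of x] norm_ge_zero order_trans by blast
    qed
    show "0 \<le> B" using assms(2) [of 0] norm_ge_zero order_trans by blast
  qed simp
  then show ?thesis
    unfolding locally_lipschitz_def by (meson lipschitz_on_subset subset_UNIV zero_less_one)
qed

lemma GDERIV_continuous: "(\<And>x. GDERIV f x :> D x) \<Longrightarrow> continuous_on UNIV f"
  unfolding gderiv_def by (meson has_derivative_continuous continuous_at_imp_continuous_on)

text \<open>
  The inequality for \<open>exp (w / 2)\<close>, whose square is \<open>exp w\<close> and whose squared gradient is
  \<open>exp w |\<nabla>w|^2 / 4\<close>.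
\<close>
lemma log_sobolev_exp:
  fixes w :: "'a :: euclidean_space \<Rightarrow> real"
  assumes "prob_space \<nu>" and [measurable_cong]: "sets \<nu> = sets borel" and "log_sobolev \<nu> C"
    and D: "\<And>x. GDERIV w x :> D x" and [measurable]: "D \<in> borel_measurable borel"
    and w: "\<And>x. \<bar>w x\<bar> \<le> K" and DK: "\<And>x. norm (D x) \<le> K"
  shows "(\<integral>x. exp (w x) * w x \<partial>\<nu>) - (\<integral>x. exp (w x) \<partial>\<nu>) * ln (\<integral>x. exp (w x) \<partial>\<nu>)
    \<le> C / 2 * (\<integral>x. exp (w x) * (norm (D x))\<^sup>2 \<partial>\<nu>)"
proof -
  interpret prob_space \<nu> by fact
  have [measurable]: "w \<in> borel_measurable borel"
    using D by (intro borel_measurable_continuous_onI GDERIV_continuous)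
  define f where "f x = exp (w x / 2)" for x
  have sq: "(f x)\<^sup>2 = exp (w x)" for x
    by (simp add: f_def flip: exp_double)
  have f: "GDERIV f x :> (exp (w x / 2) * (1 / 2)) *\<^sub>R D x" for x
    unfolding f_def by (rule GDERIV_DERIV_compose [OF D]) (auto intro!: derivative_eq_intros)
  have g: "(grad_norm f x)\<^sup>2 = exp (w x) * (norm (D x))\<^sup>2 / 4" for x
    unfolding grad_norm_eq [OF f] by (simp add: power_mult_distrib power_divide flip: exp_double)
  have w1: "w x \<le> K" for x using w [of x] by simp
  have "locally_lipschitz f"
  proof (rule locally_lipschitz_bounded_gradient [OF f])
    show "norm ((exp (w x / 2) * (1 / 2)) *\<^sub>R D x) \<le> exp (K / 2) * (1 / 2) * K" for x
      using w1 DK by (auto intro!: mult_mono)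
  qed
  moreover have "integrable \<nu> (\<lambda>x. (f x)\<^sup>2)"
    unfolding sq by (rule integrable_const_bound [of _ "exp K"]) (use w1 in auto)
  moreover have "integrable \<nu> (\<lambda>x. (grad_norm f x)\<^sup>2)"
    unfolding g
  proof (rule integrable_const_bound [of _ "exp K * K\<^sup>2 / 4"])
    show "AE x in \<nu>. norm (exp (w x) * (norm (D x))\<^sup>2 / 4) \<le> exp K * K\<^sup>2 / 4"
      using w1 DK by (auto intro!: mult_mono divide_right_mono power_mono)
  qed auto
  ultimately have "(\<integral>x. (f x)\<^sup>2 * ln ((f x)\<^sup>2) \<partial>\<nu>) - (\<integral>x. (f x)\<^sup>2 \<partial>\<nu>) * ln (\<integral>x. (f x)\<^sup>2 \<partial>\<nu>)
        \<le> 2 * C * (\<integral>x. (grad_norm f x)\<^sup>2 \<partial>\<nu>)"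
    using assms(3) unfolding log_sobolev_def by blast
  then show ?thesis
    unfolding sq g by simp
qed

text \<open>
  Entropies are nonnegative by Jensen's inequality, so it suffices to exhibit one bounded
  function whose gradient vanishes nowhere: then its energy is positive, however singular the
  measure is. The arctangent of a coordinate has this property.
\<close>
lemma log_sobolev_constant_nonneg:
  fixes \<nu> :: "'a :: euclidean_space measure"
  assumes "prob_space \<nu>" and [measurable_cong]: "sets \<nu> = sets borel" and "log_sobolev \<nu> C"
  shows "0 \<le> C"
proof -
  interpret prob_space \<nu> by fact
  obtain e :: 'a where e: "e \<in> Basis" using nonempty_Basis by blast
  define w where "w x = arctan (x \<bullet> e)" for x :: 'a
  define D where "D x = inverse (1 + (x \<bullet> e)\<^sup>2) *\<^sub>R e" for x :: 'a
  have [measurable]: "D \<in> borel_measurable borel" "w \<in> borel_measurable borel"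
    by (auto simp: D_def [abs_def] w_def [abs_def])
  have D: "GDERIV w x :> D x" for x
  proof -
    have "GDERIV (\<lambda>x. x \<bullet> e) x :> e"
      unfolding gderiv_def by (intro derivative_eq_intros) auto
    then show ?thesis
      unfolding w_def D_def by (rule GDERIV_DERIV_compose) (rule DERIV_arctan)
  qed
  have w: "\<bar>w x\<bar> \<le> 2" for x
    using arctan_bounded [of "x \<bullet> e"] pi_less_4 by (auto simp: w_def abs_le_iff)
  have DK: "norm (D x) \<le> 2" for x
  proof -
    have "inverse (1 + (x \<bullet> e)\<^sup>2) \<le> 1" by (intro inverse_le_1_iff [THEN iffD2]) auto
    then show ?thesis using e by (simp add: D_def)
  qed
  define N where "N = (\<integral>x. exp (w x) \<partial>\<nu>)"
  have w2: "- 2 \<le> w x" "w x \<le> 2" for x using w [of x] by auto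
  have i1: "integrable \<nu> (\<lambda>x. exp (w x))"
    by (rule integrable_const_bound [of _ "exp 2"]) (use w2 in auto)
  have i2: "integrable \<nu> (\<lambda>x. exp (w x) * w x)"
    by (rule integrable_const_bound [of _ "exp 2 * 2"]) (use w w2 in \<open>auto simp: abs_mult intro!: mult_mono\<close>)
  have i3: "integrable \<nu> (\<lambda>x. exp (w x) * (norm (D x))\<^sup>2)"
    by (rule integrable_const_bound [of _ "exp 2 * 2\<^sup>2"])
      (use DK w2 in \<open>auto simp: abs_mult intro!: AE_I2 mult_mono power_mono [of _ 2 2, simplified]\<close>)
  have "exp (- 2) \<le> N"
    unfolding N_def using i1 w2 by (intro integral_ge_const) auto
  then have N: "0 < N" using exp_gt_zero [of "- 2 :: real"] by linarith
  have "exp (w x) * ln N + exp (w x) - N \<le> exp (w x) * w x" for x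
  proof -
    have "ln (N / exp (w x)) \<le> N / exp (w x) - 1"
      using N by (intro ln_le_minus_one) auto
    then have "(ln N - w x) * exp (w x) \<le> (N / exp (w x) - 1) * exp (w x)"
      using N by (intro mult_right_mono) (auto simp: ln_div)
    then show ?thesis by (simp add: algebra_simps)
  qed
  then have "(\<integral>x. exp (w x) * ln N + exp (w x) - N \<partial>\<nu>) \<le> (\<integral>x. exp (w x) * w x \<partial>\<nu>)"
    using i1 i2 by (intro integral_mono) auto
  then have "N * ln N \<le> (\<integral>x. exp (w x) * w x \<partial>\<nu>)"
    using i1 by (simp add: N_def prob_space)
  moreover have "(\<integral>x. exp (w x) * w x \<partial>\<nu>) - N * ln N \<le> C / 2 * (\<integral>x. exp (w x) * (norm (D x))\<^sup>2 \<partial>\<nu>)"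
    unfolding N_def by (rule log_sobolev_exp [OF assms D _ w DK]) simp
  ultimately have 1: "0 \<le> C / 2 * (\<integral>x. exp (w x) * (norm (D x))\<^sup>2 \<partial>\<nu>)"
    by linarith
  have "0 < (\<integral>x. exp (w x) * (norm (D x))\<^sup>2 \<partial>\<nu>)"
  proof (rule ccontr)
    assume "\<not> ?thesis"
    moreover have "0 \<le> (\<integral>x. exp (w x) * (norm (D x))\<^sup>2 \<partial>\<nu>)" by simp
    ultimately have "(\<integral>x. exp (w x) * (norm (D x))\<^sup>2 \<partial>\<nu>) = 0" by linarith
    then have "AE x in \<nu>. exp (w x) * (norm (D x))\<^sup>2 = 0"
      using i3 by (subst (asm) integral_nonneg_eq_0_iff_AE) auto
    moreover have "D x \<noteq> 0" for x
    proof -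
      have "0 < 1 + (x \<bullet> e)\<^sup>2" by (simp add: add_pos_nonneg)
      then show ?thesis using e by (auto simp: D_def)
    qed
    ultimately show False by simp
  qed
  with 1 show ?thesis
    by (simp add: zero_le_mult_iff)
qed

text \<open>
  For each test function the condition on the constant is a non-strict linear inequality, and
  such inequalities pass to the infimum.
\<close>
lemma log_sobolev_C_LSI:
  assumes "prob_space \<nu>" "sets \<nu> = sets borel" "\<exists>C. log_sobolev \<nu> C"
  shows "log_sobolev \<nu> (C_LSI \<nu>)"
  unfolding log_sobolev_def
proof (intro allI impI conjI)
  fix f :: "'a \<Rightarrow> real"
  assume f: "locally_lipschitz f" "integrable \<nu> (\<lambda>x. (f x)\<^sup>2)" "integrable \<nu> (\<lambda>x. (grad_norm f x)\<^sup>2)"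
  show "integrable \<nu> (\<lambda>x. (f x)\<^sup>2 * ln ((f x)\<^sup>2))"
    using f assms(3) unfolding log_sobolev_def by blast
  define L where "L = (\<integral>x. (f x)\<^sup>2 * ln ((f x)\<^sup>2) \<partial>\<nu>) - (\<integral>x. (f x)\<^sup>2 \<partial>\<nu>) * ln (\<integral>x. (f x)\<^sup>2 \<partial>\<nu>)"
  define E where "E = (\<integral>x. (grad_norm f x)\<^sup>2 \<partial>\<nu>)"
  have L: "L \<le> 2 * C * E" if "log_sobolev \<nu> C" for C
    using f that unfolding log_sobolev_def L_def E_def by blast
  have "0 \<le> E" by (simp add: E_def)
  have "L \<le> 2 * C_LSI \<nu> * E"
  proof (cases "E = 0")
    case True
    then show ?thesis using L assms(3) by auto
  next
    case False
    with \<open>0 \<le> E\<close> have E: "0 < E" by simp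
    have "L / (2 * E) \<le> C_LSI \<nu>"
      unfolding C_LSI_def using assms(3) L E
      by (intro cInf_greatest) (auto simp: field_simps)
    then show ?thesis using E by (simp add: field_simps)
  qed
  then show "(\<integral>x. (f x)\<^sup>2 * ln ((f x)\<^sup>2) \<partial>\<nu>) - (\<integral>x. (f x)\<^sup>2 \<partial>\<nu>) * ln (\<integral>x. (f x)\<^sup>2 \<partial>\<nu>)
      \<le> 2 * C_LSI \<nu> * (\<integral>x. (grad_norm f x)\<^sup>2 \<partial>\<nu>)"
    by (simp add: L_def E_def)
qed

section \<open>Hypercontractivity along a Hamilton-Jacobi inequality\<close>

text \<open>
  The conclusion compares the logarithms of the norms of \<open>exp (u r)\<close> in \<open>L^{\<lambda>(r)}(\<nu>)\<close> at \<open>r0\<close>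
  and \<open>r1\<close>, with the affine exponent \<open>\<lambda>(r) = \<beta> + (r1 - r) \<kappa>\<close>. With \<open>N(r) = \<integral> exp (\<lambda> u r) d\<nu>\<close>,
  the derivative of \<open>ln N / \<lambda>\<close> has the sign of
  \<open>\<lambda>^2 \<integral> \<partial>_r u exp (\<lambda> u) d\<nu> - \<kappa> Ent (exp (\<lambda> u))\<close>. The logarithmic Sobolev inequality bounds
  the entropy by \<open>(C \<lambda>^2 / 2) \<integral> |\<nabla>u|^2 exp (\<lambda> u) d\<nu>\<close>, and \<open>\<kappa> C \<le> \<tau>\<close> together with
  the differential inequality makes the difference nonnegative. The condition \<open>\<kappa> C \<le> \<tau>\<close>,
  rather than \<open>\<kappa> = \<tau> / C\<close>, covers the case \<open>C = 0\<close>.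
\<close>
lemma hamilton_jacobi_hypercontractive:
  fixes u u' :: "real \<Rightarrow> 'a :: euclidean_space \<Rightarrow> real" and D :: "real \<Rightarrow> 'a \<Rightarrow> 'a"
  assumes "prob_space \<nu>" and [measurable_cong]: "sets \<nu> = sets borel" and "log_sobolev \<nu> C"
    and "0 \<le> \<kappa>" "\<kappa> * C \<le> \<tau>" "0 < \<beta>"
    and I: "r0 \<le> r1" "l < r0" "r1 < m"
    and der: "\<And>r x. r \<in> {l<..<m} \<Longrightarrow> ((\<lambda>r. u r x) has_real_derivative u' r x) (at r)"
    and grad: "\<And>r x. r \<in> {l<..<m} \<Longrightarrow> GDERIV (u r) x :> D r x"
    and bd: "\<And>r x. r \<in> {l<..<m} \<Longrightarrow> \<bar>u r x\<bar> \<le> K" "\<And>r x. r \<in> {l<..<m} \<Longrightarrow> \<bar>u' r x\<bar> \<le> K"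
      "\<And>r x. r \<in> {l<..<m} \<Longrightarrow> norm (D r x) \<le> K"
    and meas: "\<And>r. r \<in> {l<..<m} \<Longrightarrow> u' r \<in> borel_measurable borel"
      "\<And>r. r \<in> {l<..<m} \<Longrightarrow> D r \<in> borel_measurable borel"
    and hj: "\<And>r x. r \<in> {l<..<m} \<Longrightarrow> \<tau> / 2 * (norm (D r x))\<^sup>2 \<le> u' r x"
  shows "ln (\<integral>x. exp ((\<beta> + (r1 - r0) * \<kappa>) * u r0 x) \<partial>\<nu>) / (\<beta> + (r1 - r0) * \<kappa>)
    \<le> ln (\<integral>x. exp (\<beta> * u r1 x) \<partial>\<nu>) / \<beta>"
proof -
  interpret prob_space \<nu> by fact
  define lam where "lam r = \<beta> + (r1 - r) * \<kappa>" for r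
  define \<Lambda> where "\<Lambda> = \<beta> + (m - l) * \<kappa>"
  have lamI: "\<bar>lam r\<bar> \<le> \<Lambda>" if "r \<in> {l<..<m}" for r
  proof -
    have "\<bar>(r1 - r) * \<kappa>\<bar> \<le> (m - l) * \<kappa>"
      using that I assms(4) by (auto simp: abs_mult intro!: mult_right_mono)
    then show ?thesis using assms(6) by (simp add: lam_def \<Lambda>_def)
  qed
  have \<Lambda>: "0 \<le> \<Lambda>" using lamI [of r1] I by auto
  have K: "0 \<le> K" using bd(1) [of r1 0] I by auto
  have mu: "u r \<in> borel_measurable borel" if "r \<in> {l<..<m}" for r
    using grad that by (intro borel_measurable_continuous_onI GDERIV_continuous)
  have lu: "\<bar>lam r * u r x\<bar> \<le> \<Lambda> * K" if "r \<in> {l<..<m}" for r x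
    using lamI [OF that] bd(1) [OF that, of x] \<Lambda> by (auto simp: abs_mult intro!: mult_mono)
  have lu1: "lam r * u r x \<le> \<Lambda> * K" "- (\<Lambda> * K) \<le> lam r * u r x" if "r \<in> {l<..<m}" for r x
    using lu [OF that, of x] by auto
  have ei: "integrable \<nu> (\<lambda>x. exp (lam r * u r x) * v x)"
    if "r \<in> {l<..<m}" "v \<in> borel_measurable borel" "\<And>x. \<bar>v x\<bar> \<le> B" for r v B
  proof (rule integrable_const_bound [of _ "exp (\<Lambda> * K) * B"])
    show "AE x in \<nu>. norm (exp (lam r * u r x) * v x) \<le> exp (\<Lambda> * K) * B"
    proof (rule AE_I2)
      show "norm (exp (lam r * u r x) * v x) \<le> exp (\<Lambda> * K) * B" for x
        unfolding real_norm_def abs_mult using lu1 [OF that(1)] that(3) by (intro mult_mono) auto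
    qed
    show "(\<lambda>x. exp (lam r * u r x) * v x) \<in> borel_measurable \<nu>"
      using mu [OF that(1)] that(2) by measurable
  qed
  have e1: "integrable \<nu> (\<lambda>x. exp (lam r * u r x))" if "r \<in> {l<..<m}" for r
    using ei [OF that, of "\<lambda>_. 1" 1] by simp
  define N where "N r = (\<integral>x. exp (lam r * u r x) \<partial>\<nu>)" for r
  have Npos: "0 < N r" if "r \<in> {l<..<m}" for r
  proof -
    have "exp (- (\<Lambda> * K)) \<le> N r"
      unfolding N_def using e1 [OF that] lu1 [OF that] by (intro integral_ge_const) auto
    then show ?thesis using exp_gt_zero [of "- (\<Lambda> * K)"] by linarith
  qed
  define f' where "f' r x = exp (lam r * u r x) * (lam r * u' r x - \<kappa> * u r x)" for r x
  have Nder: "(N has_real_derivative (\<integral>x. f' r x \<partial>\<nu>)) (at r)" if r: "r \<in> {l<..<m}" for r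
    unfolding N_def
  proof (rule has_real_derivative_integral [where K = "exp (\<Lambda> * K) * (\<Lambda> * K + \<kappa> * K)", OF _ r])
    show "finite_measure \<nu>" by unfold_locales
    show "((\<lambda>s. exp (lam s * u s x)) has_real_derivative f' s x) (at s)" if "s \<in> {l<..<m}" for s x
      unfolding f'_def lam_def
      by (auto intro!: derivative_eq_intros der [OF that] simp: algebra_simps)
    show "\<bar>f' s x\<bar> \<le> exp (\<Lambda> * K) * (\<Lambda> * K + \<kappa> * K)" if "s \<in> {l<..<m}" for s x
    proof -
      have "\<bar>lam s * u' s x\<bar> \<le> \<Lambda> * K" "\<bar>\<kappa> * u s x\<bar> \<le> \<kappa> * K"
        using lamI [OF that] bd(1,2) [OF that, of x] \<Lambda> assms(4) by (auto simp: abs_mult intro!: mult_mono)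
      then have "\<bar>lam s * u' s x - \<kappa> * u s x\<bar> \<le> \<Lambda> * K + \<kappa> * K" by linarith
      then show ?thesis
        unfolding f'_def abs_mult using lu1 [OF that, of x] by (intro mult_mono) auto
    qed
    show "integrable \<nu> (\<lambda>x. exp (lam s * u s x))" if "s \<in> {l<..<m}" for s
      using e1 [OF that] .
    show "f' r \<in> borel_measurable \<nu>"
      unfolding f'_def using mu [OF r] meas(1) [OF r] by measurable
  qed
  have "ln (N r0) / lam r0 \<le> ln (N r1) / lam r1"
  proof (rule DERIV_nonneg_imp_nondecreasing [OF I(1)])
    fix r assume r01: "r0 \<le> r" "r \<le> r1"
    then have r: "r \<in> {l<..<m}" using I by auto
    have lam: "0 < lam r" using r01 assms(4,6) by (simp add: lam_def add_pos_nonneg)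
    define J where "J = (\<integral>x. exp (lam r * u r x) * (norm (D r x))\<^sup>2 \<partial>\<nu>)"
    have i2: "integrable \<nu> (\<lambda>x. exp (lam r * u r x) * (norm (D r x))\<^sup>2)"
    proof (rule ei [OF r, of _ "K\<^sup>2"])
      show "\<bar>(norm (D r x))\<^sup>2\<bar> \<le> K\<^sup>2" for x using bd(3) [OF r, of x] by (simp add: power_mono)
      show "(\<lambda>x. (norm (D r x))\<^sup>2) \<in> borel_measurable borel" using meas(2) [OF r] by measurable
    qed
    have i3: "integrable \<nu> (\<lambda>x. exp (lam r * u r x) * u' r x)"
      by (rule ei [OF r meas(1) [OF r] bd(2) [OF r]])
    have i4: "integrable \<nu> (\<lambda>x. exp (lam r * u r x) * (lam r * u r x))"
      by (rule ei [OF r _ lu [OF r]]) (use mu [OF r] in measurable)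
    have "(\<integral>x. exp (lam r * u r x) * (lam r * u r x) \<partial>\<nu>) - N r * ln (N r)
        \<le> C / 2 * (\<integral>x. exp (lam r * u r x) * (norm (lam r *\<^sub>R D r x))\<^sup>2 \<partial>\<nu>)"
      unfolding N_def
    proof (rule log_sobolev_exp [OF assms(1-3), where K = "\<Lambda> * K"])
      have "GDERIV (\<lambda>x. lam r * u r x) x :> lam r *\<^sub>R D r x + u r x *\<^sub>R 0" for x
        by (rule GDERIV_mult [OF GDERIV_const grad [OF r]])
      then show "GDERIV (\<lambda>x. lam r * u r x) x :> lam r *\<^sub>R D r x" for x by simp
      show "(\<lambda>x. lam r *\<^sub>R D r x) \<in> borel_measurable borel" using meas(2) [OF r] by measurable
      show "norm (lam r *\<^sub>R D r x) \<le> \<Lambda> * K" for x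
        using lamI [OF r] bd(3) [OF r, of x] \<Lambda> by (auto intro!: mult_mono)
    qed (rule lu [OF r])
    also have "(\<integral>x. exp (lam r * u r x) * (norm (lam r *\<^sub>R D r x))\<^sup>2 \<partial>\<nu>) = (lam r)\<^sup>2 * J"
      by (simp add: J_def power_mult_distrib mult.left_commute)
    finally have "\<kappa> * ((\<integral>x. exp (lam r * u r x) * (lam r * u r x) \<partial>\<nu>) - N r * ln (N r))
        \<le> \<kappa> * (C / 2 * ((lam r)\<^sup>2 * J))"
      using assms(4) by (rule mult_left_mono)
    also have "\<dots> = (\<kappa> * C) * ((lam r)\<^sup>2 * J / 2)" by simp
    also have "\<dots> \<le> \<tau> * ((lam r)\<^sup>2 * J / 2)"
      using assms(5) by (intro mult_right_mono) (auto simp: J_def)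
    also have "\<dots> = (lam r)\<^sup>2 * (\<tau> / 2 * J)" by simp
    also have "\<tau> / 2 * J = (\<integral>x. exp (lam r * u r x) * (\<tau> / 2 * (norm (D r x))\<^sup>2) \<partial>\<nu>)"
      by (simp add: J_def mult_ac)
    also have "\<dots> \<le> (\<integral>x. exp (lam r * u r x) * u' r x \<partial>\<nu>)"
    proof (rule integral_mono)
      show "integrable \<nu> (\<lambda>x. exp (lam r * u r x) * (\<tau> / 2 * (norm (D r x))\<^sup>2))"
        using integrable_mult_right [OF i2, of "\<tau> / 2"] by (simp add: mult_ac)
    qed (use i3 hj [OF r] in auto)
    finally have key: "\<kappa> * ((\<integral>x. exp (lam r * u r x) * (lam r * u r x) \<partial>\<nu>) - N r * ln (N r))
        \<le> (lam r)\<^sup>2 * (\<integral>x. exp (lam r * u r x) * u' r x \<partial>\<nu>)"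
      by (simp add: mult_left_mono)
    have "lam r * (\<integral>x. f' r x \<partial>\<nu>) = (\<integral>x. (lam r)\<^sup>2 * (exp (lam r * u r x) * u' r x)
        - \<kappa> * (exp (lam r * u r x) * (lam r * u r x)) \<partial>\<nu>)"
      unfolding f'_def integral_mult_right_zero [symmetric]
      by (intro Bochner_Integration.integral_cong) (auto simp: algebra_simps power2_eq_square)
    also have "\<dots> = (lam r)\<^sup>2 * (\<integral>x. exp (lam r * u r x) * u' r x \<partial>\<nu>)
        - \<kappa> * (\<integral>x. exp (lam r * u r x) * (lam r * u r x) \<partial>\<nu>)"
      using i3 i4 by (subst Bochner_Integration.integral_diff) auto
    finally have "0 \<le> lam r * (\<integral>x. f' r x \<partial>\<nu>) + \<kappa> * (N r * ln (N r))"
      using key by (simp add: right_diff_distrib)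
    also have "\<dots> = ((\<integral>x. f' r x \<partial>\<nu>) / N r * lam r + ln (N r) * \<kappa>) * N r"
      using Npos [OF r] by (simp add: field_simps)
    finally have "0 \<le> (\<integral>x. f' r x \<partial>\<nu>) / N r * lam r + ln (N r) * \<kappa>"
      using Npos [OF r] by (simp add: zero_le_mult_iff)
    then have "0 \<le> ((\<integral>x. f' r x \<partial>\<nu>) / N r * lam r + ln (N r) * \<kappa>) / (lam r)\<^sup>2"
      by simp
    moreover have "((\<lambda>r. ln (N r) / lam r) has_real_derivative
        ((\<integral>x. f' r x \<partial>\<nu>) / N r * lam r + ln (N r) * \<kappa>) / (lam r)\<^sup>2) (at r)"
    proof -
      have "(lam has_real_derivative - \<kappa>) (at r)"
        unfolding lam_def by (auto intro!: derivative_eq_intros)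
      then show ?thesis
        using Npos [OF r] lam
        by (auto intro!: derivative_eq_intros Nder [OF r] simp: power2_eq_square field_simps)
    qed
    ultimately show "\<exists>y. ((\<lambda>r. ln (N r) / lam r) has_real_derivative y) (at r) \<and> 0 \<le> y"
      by blast
  qed
  then show ?thesis
    by (simp add: N_def lam_def)
qed

section \<open>Power means of the heat semigroup\<close>

text \<open>
  Here \<open>L\<close> is the logarithm of the function on which the semigroup acts, and
  \<open>heat_exp r x\<close> is the value at \<open>x\<close> of the semigroup applied to the \<open>r\<close>-th power
  of that function.
\<close>
context
  fixes t B :: real and L :: "real ^ 'n \<Rightarrow> real"
  assumes t: "0 < t" and L [measurable]: "L \<in> borel_measurable borel" and LB: "\<And>z. \<bar>L z\<bar> \<le> B"
begin

definition heat_exp :: "real \<Rightarrow> real ^ 'n \<Rightarrow> real" where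
  "heat_exp r x = (\<integral>z. exp (r * L z) \<partial>gauss_at t x)"

definition heat_exp_dr :: "real \<Rightarrow> real ^ 'n \<Rightarrow> real" where
  "heat_exp_dr r x = (\<integral>z. exp (r * L z) * L z \<partial>gauss_at t x)"

definition heat_exp_grad :: "real \<Rightarrow> real ^ 'n \<Rightarrow> real ^ 'n" where
  "heat_exp_grad r x = (\<integral>z. exp (r * L z) *\<^sub>R ((z - x) /\<^sub>R t) \<partial>gauss_at t x)"

lemma log_bound_nonneg: "0 \<le> B"
  using LB [of 0] by linarith

lemma abs_scaled_log_le: "\<bar>r * L z\<bar> \<le> \<bar>r\<bar> * B"
  using LB by (simp add: abs_mult mult_left_mono)

lemma exp_scaled_log_bounds: "exp (r * L z) \<le> exp (\<bar>r\<bar> * B)" "exp (- (\<bar>r\<bar> * B)) \<le> exp (r * L z)"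
  using abs_scaled_log_le [of r z] by auto

lemma integrable_exp_scaled_log:
  assumes "v \<in> borel_measurable borel" "integrable (gauss_at t x) v"
  shows "integrable (gauss_at t x) (\<lambda>z. exp (r * L z) * v z)"
  by (rule Bochner_Integration.integrable_bound [OF integrable_mult_right [OF assms(2), of "exp (\<bar>r\<bar> * B)"]])
    (use assms(1) exp_scaled_log_bounds in \<open>auto simp: abs_mult intro!: AE_I2 mult_right_mono\<close>)

lemma heat_exp_bounds: "exp (- (\<bar>r\<bar> * B)) \<le> heat_exp r x" "heat_exp r x \<le> exp (\<bar>r\<bar> * B)"
proof -
  interpret N: prob_space "gauss_at t x" by (rule prob_space_gauss_at [OF t])
  have i: "integrable (gauss_at t x) (\<lambda>z. exp (r * L z))"
    using integrable_exp_scaled_log [of "\<lambda>_. 1"] by simp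
  show "exp (- (\<bar>r\<bar> * B)) \<le> heat_exp r x"
    unfolding heat_exp_def by (rule N.integral_ge_const [OF i]) (use exp_scaled_log_bounds in auto)
  show "heat_exp r x \<le> exp (\<bar>r\<bar> * B)"
    unfolding heat_exp_def by (rule N.integral_le_const [OF i]) (use exp_scaled_log_bounds in auto)
qed

lemma heat_exp_pos: "0 < heat_exp r x"
  using heat_exp_bounds(1) [of r x] exp_gt_zero less_le_trans by blast

lemma heat_exp_dr_bound: "\<bar>heat_exp_dr r x\<bar> \<le> B * heat_exp r x"
proof -
  interpret N: prob_space "gauss_at t x" by (rule prob_space_gauss_at [OF t])
  have i: "integrable (gauss_at t x) (\<lambda>z. exp (r * L z))"
    using integrable_exp_scaled_log [of "\<lambda>_. 1"] by simp
  have i2: "integrable (gauss_at t x) (\<lambda>z. exp (r * L z) * L z)"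
    by (rule integrable_exp_scaled_log) (auto intro!: N.integrable_const_bound [of _ B] simp: LB)
  have "\<bar>heat_exp_dr r x\<bar> \<le> (\<integral>z. \<bar>exp (r * L z) * L z\<bar> \<partial>gauss_at t x)"
    unfolding heat_exp_dr_def by (rule integral_abs_bound)
  also have "\<dots> \<le> (\<integral>z. exp (r * L z) * B \<partial>gauss_at t x)"
    using i LB integrable_abs [OF i2] by (intro integral_mono) (auto simp: abs_mult)
  also have "\<dots> = B * heat_exp r x" by (simp add: heat_exp_def)
  finally show ?thesis .
qed

lemma DERIV_heat_exp: "((\<lambda>r. heat_exp r x) has_real_derivative heat_exp_dr r x) (at r)"
proof -
  interpret N: prob_space "gauss_at t x" by (rule prob_space_gauss_at [OF t])
  have "GDERIV (\<lambda>h. \<integral>z. exp (r * L z) * exp (h \<bullet> L z) \<partial>gauss_at t x) 0 :>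
      (\<integral>z. exp (r * L z) *\<^sub>R L z \<partial>gauss_at t x)"
  proof (rule GDERIV_exp_integral)
    show "integrable (gauss_at t x) (\<lambda>z. exp (r * L z) * exp (2 * norm (L z)))"
      by (rule integrable_exp_scaled_log) (auto intro!: N.integrable_const_bound [of _ "exp (2 * B)"] simp: LB)
  qed auto
  then have "((\<lambda>h. heat_exp (h + r) x) has_real_derivative heat_exp_dr r x) (at 0)"
    by (simp add: heat_exp_def heat_exp_dr_def distrib_right exp_add mult.commute [of "exp (r * _)"])
  then show ?thesis
    using DERIV_shift [of "\<lambda>r. heat_exp r x" "heat_exp_dr r x" 0 r] by simp
qed

lemma integrable_linear_gauss_at: "integrable (gauss_at t x) (\<lambda>z. (z - x) \<bullet> v)"
proof (rule Bochner_Integration.integrable_bound [OF integrable_gauss_at_exp_norm [OF t, of x "norm v"]])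
  have "\<bar>(z - x) \<bullet> v\<bar> \<le> exp (norm v * norm (z - x))" for z
    using Cauchy_Schwarz_ineq2 [of "z - x" v] exp_ge_add_one_self [of "norm v * norm (z - x)"]
    unfolding mult.commute [of "norm v"] by linarith
  then show "AE z in gauss_at t x. norm ((z - x) \<bullet> v) \<le> norm (exp (norm v * norm (z - x)))"
    by simp
qed auto

text \<open>
  By the tilting formula, \<open>heat_exp r (x + h)\<close> is a Laplace transform in \<open>h\<close> times
  \<open>exp (- |h|^2 / (2 t))\<close>, a factor whose gradient vanishes at the origin.
\<close>
lemma GDERIV_heat_exp: "GDERIV (heat_exp r) x :> heat_exp_grad r x"
proof -
  define A where "A h = (\<integral>z. exp (r * L z) * exp (h \<bullet> ((z - x) /\<^sub>R t)) \<partial>gauss_at t x)" for h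
  have A: "GDERIV A 0 :> heat_exp_grad r x"
    unfolding A_def heat_exp_grad_def
  proof (rule GDERIV_exp_integral)
    have "integrable (gauss_at t x) (\<lambda>z. exp (2 * norm ((z - x) /\<^sub>R t)))"
      using integrable_gauss_at_exp_norm [OF t, of x "2 / t"] t by (simp add: divide_inverse mult.assoc)
    then show "integrable (gauss_at t x) (\<lambda>z. exp (r * L z) * exp (2 * norm ((z - x) /\<^sub>R t)))"
      by (intro integrable_exp_scaled_log) auto
  qed auto
  have E: "GDERIV (\<lambda>h :: real ^ 'n. exp (- (norm h)\<^sup>2 / (2 * t))) 0 :> 0"
    unfolding gderiv_def power2_norm_eq_inner using t by (auto intro!: derivative_eq_intros)
  have "(\<lambda>h. heat_exp r (x + h)) = (\<lambda>h. exp (- (norm h)\<^sup>2 / (2 * t)) * A h)"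
    unfolding heat_exp_def A_def by (subst integral_gauss_at_tilt [OF t]) auto
  then have "GDERIV (\<lambda>h. heat_exp r (x + h)) 0 :> heat_exp_grad r x"
    using GDERIV_mult [OF E A] by simp
  then have "((\<lambda>h. heat_exp r (x + h)) has_derivative (\<lambda>h. h \<bullet> heat_exp_grad r x)) (at ((\<lambda>y. y - x) x))"
    by (simp add: gderiv_def)
  moreover have "((\<lambda>y. y - x) has_derivative (\<lambda>h. h)) (at x)"
    by (auto intro!: derivative_eq_intros)
  ultimately have "((\<lambda>y. heat_exp r (x + (y - x))) has_derivative (\<lambda>h. h \<bullet> heat_exp_grad r x)) (at x)"
    by (rule has_derivative_compose [rotated])
  then show ?thesis
    by (simp add: gderiv_def)
qed

text \<open>
  The right-hand side is the relative entropy, with respect to the Gaussian measure centred at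
  \<open>x\<close>, of the probability density \<open>a = exp (r L) / heat_exp r x\<close>. By the variational formula it is
  at least \<open>\<integral> a s\<close> for every \<open>s\<close> with \<open>\<integral> exp s = 1\<close>. Among the functions
  \<open>s(z) = (z - x) \<bullet> v - t |v|^2 / 2\<close>, the best choice of \<open>v\<close> is the logarithmic gradient of
  \<open>heat_exp r\<close> at \<open>x\<close>: its product with \<open>t\<close> is the mean of \<open>z - x\<close> under \<open>a\<close>, which gives
  \<open>\<integral> a s = t |v|^2 / 2\<close>.
\<close>
lemma reverse_log_sobolev:
  "t / 2 * (norm (heat_exp_grad r x /\<^sub>R heat_exp r x))\<^sup>2 \<le> r * heat_exp_dr r x / heat_exp r x - ln (heat_exp r x)"
proof -
  interpret N: prob_space "gauss_at t x" by (rule prob_space_gauss_at [OF t])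
  define v where "v = heat_exp_grad r x /\<^sub>R heat_exp r x"
  define a where "a z = exp (r * L z) / heat_exp r x" for z
  define s where "s z = (z - x) \<bullet> v - t / 2 * (norm v)\<^sup>2" for z
  have es: "exp (s z) = exp (- (norm (t *\<^sub>R v))\<^sup>2 / (2 * t)) * exp ((t *\<^sub>R v) \<bullet> ((z - x) /\<^sub>R t))" for z
  proof -
    have "(t *\<^sub>R v) \<bullet> ((z - x) /\<^sub>R t) = (z - x) \<bullet> v"
      using t by (simp only: inner_scaleR_left inner_scaleR_right inner_commute) simp
    moreover have "- (norm (t *\<^sub>R v))\<^sup>2 / (2 * t) = - (t / 2 * (norm v)\<^sup>2)"
      using t by (simp add: power_mult_distrib power2_eq_square)
    ultimately show ?thesis
      unfolding s_def exp_add [symmetric] by simp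
  qed
  have s_meas [measurable]: "s \<in> borel_measurable borel" unfolding s_def by measurable
  have int_es: "(\<integral>z. exp (s z) \<partial>gauss_at t x) = 1"
  proof -
    have "(\<integral>z. exp (s z) \<partial>gauss_at t x) = exp (- (norm (t *\<^sub>R v))\<^sup>2 / (2 * t)) *
        (\<integral>z. 1 * exp ((t *\<^sub>R v) \<bullet> ((z - x) /\<^sub>R t)) \<partial>gauss_at t x)"
      unfolding es by simp
    also have "\<dots> = (\<integral>z. 1 \<partial>gauss_at t (x + t *\<^sub>R v))"
      by (rule integral_gauss_at_tilt [OF t, symmetric]) simp
    also have "\<dots> = 1"
    proof -
      interpret N': prob_space "gauss_at t (x + t *\<^sub>R v)" by (rule prob_space_gauss_at [OF t])
      show ?thesis using N'.prob_space by simp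
    qed
    finally show ?thesis .
  qed
  have i_es: "integrable (gauss_at t x) (\<lambda>z. exp (s z))"
    using int_es not_integrable_integral_eq by fastforce
  have i_s: "integrable (gauss_at t x) s"
    unfolding s_def by (intro Bochner_Integration.integrable_diff integrable_linear_gauss_at N.integrable_const)
  have i_L: "integrable (gauss_at t x) L"
    by (rule N.integrable_const_bound [of _ B]) (auto simp: LB)
  \<comment> \<open>Young's inequality for the conjugate pair \<open>y ln y - y\<close> and \<open>exp\<close>.\<close>
  have young: "a z * s z \<le> a z * (r * L z - ln (heat_exp r x)) - a z + exp (s z)" for z
  proof -
    have a: "0 < a z" "ln (a z) = r * L z - ln (heat_exp r x)"
      using heat_exp_pos [of r x] by (auto simp: a_def ln_div)
    have "ln (exp (s z) / a z) \<le> exp (s z) / a z - 1"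
      using a by (intro ln_le_minus_one) auto
    then have "(s z - ln (a z)) * a z \<le> (exp (s z) / a z - 1) * a z"
      using a by (intro mult_right_mono) (auto simp: ln_div)
    then show ?thesis using a by (simp add: algebra_simps)
  qed
  have i_a: "integrable (gauss_at t x) (\<lambda>z. exp (r * L z))"
    using integrable_exp_scaled_log [of "\<lambda>_. 1"] by simp
  have i_aL: "integrable (gauss_at t x) (\<lambda>z. exp (r * L z) * L z)"
    by (rule integrable_exp_scaled_log [OF _ i_L]) simp
  have i_as: "integrable (gauss_at t x) (\<lambda>z. exp (r * L z) * s z)"
    by (rule integrable_exp_scaled_log [OF _ i_s]) simp
  have i_al: "integrable (gauss_at t x) (\<lambda>z. exp (r * L z) * ((z - x) \<bullet> v))"
    by (rule integrable_exp_scaled_log [OF _ integrable_linear_gauss_at]) simp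
  have i_g: "integrable (gauss_at t x) (\<lambda>z. exp (r * L z) *\<^sub>R ((z - x) /\<^sub>R t))"
  proof (rule Bochner_Integration.integrable_bound)
    show "integrable (gauss_at t x) (\<lambda>z. exp (r * L z) * exp (inverse t * norm (z - x)))"
      by (intro integrable_exp_scaled_log integrable_gauss_at_exp_norm [OF t]) auto
    have "inverse t * norm (z - x) \<le> exp (inverse t * norm (z - x))" for z
      using exp_ge_add_one_self [of "inverse t * norm (z - x)"] by linarith
    then show "AE z in gauss_at t x. norm (exp (r * L z) *\<^sub>R ((z - x) /\<^sub>R t))
        \<le> norm (exp (r * L z) * exp (inverse t * norm (z - x)))"
      using t by (auto intro!: mult_left_mono)
  qed auto
  have "(\<integral>z. exp (r * L z) * ((z - x) \<bullet> v) \<partial>gauss_at t x) =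
      (\<integral>z. t * ((exp (r * L z) *\<^sub>R ((z - x) /\<^sub>R t)) \<bullet> v) \<partial>gauss_at t x)"
    using t by (intro Bochner_Integration.integral_cong) auto
  also have "\<dots> = t * (heat_exp_grad r x \<bullet> v)"
    using i_g by (simp add: heat_exp_grad_def flip: integral_inner_left)
  also have "\<dots> = t * heat_exp r x * (norm v)\<^sup>2"
  proof -
    have "heat_exp_grad r x = heat_exp r x *\<^sub>R v" using heat_exp_pos [of r x] by (simp add: v_def)
    then show ?thesis by (simp only: inner_scaleR_left power2_norm_eq_inner mult.assoc)
  qed
  finally have lin: "(\<integral>z. exp (r * L z) * ((z - x) \<bullet> v) \<partial>gauss_at t x) = t * heat_exp r x * (norm v)\<^sup>2" .
  have "(\<integral>z. exp (r * L z) * s z \<partial>gauss_at t x) = t * heat_exp r x * (norm v)\<^sup>2 - heat_exp r x * (t / 2 * (norm v)\<^sup>2)"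
    using i_a i_al lin by (simp add: s_def heat_exp_def right_diff_distrib)
  then have as: "(\<integral>z. a z * s z \<partial>gauss_at t x) = t / 2 * (norm v)\<^sup>2"
    using heat_exp_pos [of r x] by (simp add: a_def field_simps)
  have i_aL': "integrable (gauss_at t x) (\<lambda>z. exp (r * L z) * (r * L z - ln (heat_exp r x)))"
    using Bochner_Integration.integrable_diff [OF integrable_mult_right [OF i_aL, of r] integrable_mult_right [OF i_a, of "ln (heat_exp r x)"]]
    by (simp add: algebra_simps)
  have "(\<integral>z. exp (r * L z) * (r * L z - ln (heat_exp r x)) \<partial>gauss_at t x) =
      (\<integral>z. r * (exp (r * L z) * L z) - ln (heat_exp r x) * exp (r * L z) \<partial>gauss_at t x)"
    by (intro Bochner_Integration.integral_cong) (auto simp: algebra_simps)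
  also have "\<dots> = r * heat_exp_dr r x - ln (heat_exp r x) * heat_exp r x"
    using i_aL i_a by (simp add: heat_exp_dr_def heat_exp_def)
  finally have ent: "(\<integral>z. a z * (r * L z - ln (heat_exp r x)) \<partial>gauss_at t x) = r * heat_exp_dr r x / heat_exp r x - ln (heat_exp r x)"
    using heat_exp_pos [of r x] by (simp add: a_def field_simps)
  have a1: "(\<integral>z. a z \<partial>gauss_at t x) = 1"
    using heat_exp_pos [of r x] by (simp add: a_def flip: heat_exp_def)
  have ints: "integrable (gauss_at t x) (\<lambda>z. a z * s z)" "integrable (gauss_at t x) a"
    "integrable (gauss_at t x) (\<lambda>z. a z * (r * L z - ln (heat_exp r x)))"
    unfolding a_def using i_as i_a i_aL' by auto
  have "t / 2 * (norm v)\<^sup>2 \<le> (\<integral>z. a z * (r * L z - ln (heat_exp r x)) - a z + exp (s z) \<partial>gauss_at t x)"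
    unfolding as [symmetric] using young ints i_es by (intro integral_mono) auto
  also have "\<dots> = r * heat_exp_dr r x / heat_exp r x - ln (heat_exp r x)"
    using ints i_es by (simp add: ent a1 int_es)
  finally show ?thesis
    by (simp add: v_def)
qed

text \<open>
  The general monotonicity applies to \<open>u r = ln (heat_exp r) / r\<close>, since \<open>r^2 \<partial>_r u\<close> is the
  entropy in \<open>reverse_log_sobolev\<close>. The differential inequality also bounds the gradient of \<open>u\<close>
  by its derivative in \<open>r\<close>, which in turn is bounded by a multiple of the bound for \<open>L\<close>.
\<close>
lemma heat_exp_interpolation:
  assumes \<nu>: "prob_space \<nu>" "sets \<nu> = sets borel" "log_sobolev \<nu> C"
    and "0 \<le> \<kappa>" "\<kappa> * C \<le> t" "1 \<le> b"
  shows "ln (\<integral>x. heat_exp 1 x powr (b + (b - 1) * \<kappa>) \<partial>\<nu>) / (b + (b - 1) * \<kappa>) \<le> ln (\<integral>x. heat_exp b x \<partial>\<nu>) / b"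
proof -
  define u where "u r x = ln (heat_exp r x) / r" for r x
  define u' where "u' r x = (r * heat_exp_dr r x / heat_exp r x - ln (heat_exp r x)) / r\<^sup>2" for r x
  define D where "D r x = heat_exp_grad r x /\<^sub>R heat_exp r x /\<^sub>R r" for r x
  \<comment> \<open>A common bound for \<open>u\<close>, its \<open>r\<close>-derivative and its gradient on a neighbourhood of \<open>{1..b}\<close>.\<close>
  define K where "K = 8 * B + sqrt (16 * B / t)"
  have K: "8 * B \<le> K" "sqrt (16 * B / t) \<le> K" "0 \<le> 8 * B"
    using log_bound_nonneg t by (auto simp: K_def)
  have ln_heat_exp: "\<bar>ln (heat_exp r x)\<bar> \<le> r * B" if "0 < r" for r x
  proof -
    have "- (r * B) \<le> ln (heat_exp r x)"
      using heat_exp_bounds(1) [of r x] heat_exp_pos [of r x] that by (subst ln_ge_iff) auto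
    moreover have "ln (heat_exp r x) \<le> r * B"
      using heat_exp_bounds(2) [of r x] heat_exp_pos [of r x] that by (metis abs_of_pos exp_gt_zero ln_exp ln_le_cancel_iff)
    ultimately show ?thesis by auto
  qed
  have ub: "\<bar>u r x\<bar> \<le> B" if "0 < r" for r x
    using ln_heat_exp [OF that, of x] that by (simp add: u_def abs_divide field_simps)
  have u'b: "\<bar>u' r x\<bar> \<le> 4 * B" if "1 / 2 < r" for r x
  proof -
    have "\<bar>heat_exp_dr r x / heat_exp r x\<bar> \<le> B"
      using heat_exp_dr_bound [of r x] heat_exp_pos [of r x] by (simp add: abs_divide field_simps)
    then have 1: "\<bar>r * (heat_exp_dr r x / heat_exp r x)\<bar> \<le> r * B"
      unfolding abs_mult using that by (simp add: mult_left_mono del: times_divide_eq_right abs_divide)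
    have 2: "\<bar>ln (heat_exp r x)\<bar> \<le> r * B"
      using that by (intro ln_heat_exp) simp
    have "\<bar>r * heat_exp_dr r x / heat_exp r x - ln (heat_exp r x)\<bar> \<le> 2 * (r * B)"
    proof -
      have "\<bar>c - d\<bar> \<le> 2 * e" if "\<bar>c\<bar> \<le> e" "\<bar>d\<bar> \<le> e" for c d e :: real
        using that by linarith
      from this [OF 1 2] show ?thesis by simp
    qed
    also have "\<dots> \<le> 4 * B * r\<^sup>2"
    proof -
      have "1 * (2 * (r * B)) \<le> (2 * r) * (2 * (r * B))"
        using that log_bound_nonneg by (intro mult_right_mono) auto
      then show ?thesis by (simp add: power2_eq_square)
    qed
    finally have "\<bar>r * heat_exp_dr r x / heat_exp r x - ln (heat_exp r x)\<bar> / r\<^sup>2 \<le> 4 * B"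
      using that by (subst pos_divide_le_eq) auto
    moreover have "\<bar>u' r x\<bar> = \<bar>r * heat_exp_dr r x / heat_exp r x - ln (heat_exp r x)\<bar> / r\<^sup>2"
      unfolding u'_def abs_divide by simp
    ultimately show ?thesis by simp
  qed
  have hj: "t / 2 * (norm (D r x))\<^sup>2 \<le> u' r x" if "0 < r" for r x
  proof -
    have "t / 2 * (norm (D r x))\<^sup>2 = t / 2 * (norm (heat_exp_grad r x /\<^sub>R heat_exp r x))\<^sup>2 / r\<^sup>2"
    proof -
      have "norm (D r x) = norm (heat_exp_grad r x /\<^sub>R heat_exp r x) / r"
        using that unfolding D_def norm_scaleR [of "inverse r"] by (simp add: divide_inverse_commute)
      then show ?thesis by (simp only: power_divide times_divide_eq_right)
    qed
    also have "\<dots> \<le> u' r x"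
      unfolding u'_def by (intro divide_right_mono reverse_log_sobolev) auto
    finally show ?thesis .
  qed
  have Db: "norm (D r x) \<le> sqrt (16 * B / t)" if "1 / 2 < r" for r x
  proof (rule real_le_rsqrt)
    have "t / 2 * (norm (D r x))\<^sup>2 \<le> 4 * B"
      using hj [of r x] u'b [OF that, of x] that by auto
    then show "(norm (D r x))\<^sup>2 \<le> 16 * B / t"
      using t log_bound_nonneg by (simp add: field_simps)
  qed
  have "ln (\<integral>x. exp ((b + (b - 1) * \<kappa>) * u 1 x) \<partial>\<nu>) / (b + (b - 1) * \<kappa>)
      \<le> ln (\<integral>x. exp (b * u b x) \<partial>\<nu>) / b"
  proof (rule hamilton_jacobi_hypercontractive [where l = "1 / 2" and m = "b + 1", OF \<nu> assms(4,5)])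
    fix r :: real assume r: "r \<in> {1 / 2<..<b + 1}"
    then have r0: "0 < r" "1 / 2 < r" by auto
    show "((\<lambda>r. u r x) has_real_derivative u' r x) (at r)" for x
      unfolding u_def u'_def using r0 heat_exp_pos [of r x]
      by (auto intro!: derivative_eq_intros DERIV_heat_exp simp: power2_eq_square field_simps)
    show "GDERIV (u r) x :> D r x" for x
    proof -
      have "((\<lambda>y. ln y / r) has_real_derivative inverse (heat_exp r x) * inverse r) (at (heat_exp r x))"
        using r0 heat_exp_pos [of r x] by (auto intro!: derivative_eq_intros simp: field_simps)
      from GDERIV_DERIV_compose [OF GDERIV_heat_exp this] show ?thesis
        by (simp add: u_def [abs_def] D_def mult.commute)
    qed
    show "\<bar>u r x\<bar> \<le> K" "\<bar>u' r x\<bar> \<le> K" "norm (D r x) \<le> K" for x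
      using ub [OF r0(1), of x] u'b [OF r0(2), of x] Db [OF r0(2), of x] K log_bound_nonneg by linarith+
    show "u' r \<in> borel_measurable borel" "D r \<in> borel_measurable borel"
      unfolding u'_def D_def heat_exp_def heat_exp_dr_def heat_exp_grad_def by measurable
    show "t / 2 * (norm (D r x))\<^sup>2 \<le> u' r x" for x
      using hj [OF r0(1)] .
  qed (use assms in auto)
  moreover have "exp ((b + (b - 1) * \<kappa>) * u 1 x) = heat_exp 1 x powr (b + (b - 1) * \<kappa>)" for x
    using heat_exp_pos [of 1 x] by (simp add: u_def powr_def)
  moreover have "exp (b * u b x) = heat_exp b x" for x
    using heat_exp_pos [of b x] assms(6) by (simp add: u_def)
  ultimately show ?thesis by simp
qed

end

section \<open>Hypercontractivity of the heat semigroup\<close>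

lemma heat_hypercontractive_pos:
  fixes g :: "real ^ 'n \<Rightarrow> real"
  assumes \<nu>: "prob_space \<nu>" "sets \<nu> = sets borel" "log_sobolev \<nu> C"
    and t: "0 < t" and \<kappa>: "0 \<le> \<kappa>" "\<kappa> * C \<le> t" and b: "1 \<le> b"
    and g [measurable]: "g \<in> borel_measurable borel" and "0 < e" and gM: "\<And>z. e \<le> g z" "\<And>z. g z \<le> M"
  shows "(\<integral>x. (\<integral>z. g z \<partial>gauss_at t x) powr (b + (b - 1) * \<kappa>) \<partial>\<nu>) powr (1 / (b + (b - 1) * \<kappa>))
    \<le> (\<integral>x. \<integral>z. g z powr b \<partial>gauss_at t x \<partial>\<nu>) powr (1 / b)"
proof -
  interpret \<nu>: prob_space \<nu> by fact
  define L where "L z = ln (g z)" for z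
  define B where "B = max \<bar>ln e\<bar> \<bar>ln M\<bar>"
  have gpos: "0 < g z" for z using gM(1) [of z] assms(9) by linarith
  have L [measurable]: "L \<in> borel_measurable borel" unfolding L_def by measurable
  have LB: "\<bar>L z\<bar> \<le> B" for z
  proof -
    have "ln e \<le> L z" "L z \<le> ln M"
      unfolding L_def using gpos [of z] assms(9) gM [of z] by (auto intro!: ln_mono)
    then show ?thesis by (auto simp: B_def)
  qed
  define X where "X = (\<integral>x. (\<integral>z. g z \<partial>gauss_at t x) powr (b + (b - 1) * \<kappa>) \<partial>\<nu>)"
  define Y where "Y = (\<integral>x. \<integral>z. g z powr b \<partial>gauss_at t x \<partial>\<nu>)"
  have H1: "heat_exp t L 1 x = (\<integral>z. g z \<partial>gauss_at t x)" for x
    unfolding heat_exp_def [OF t L LB] L_def using gpos by simp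
  have Hb: "heat_exp t L b x = (\<integral>z. g z powr b \<partial>gauss_at t x)" for x
    unfolding heat_exp_def [OF t L LB] L_def using gpos by (simp add: powr_def less_imp_neq [THEN not_sym])
  have le: "ln X / (b + (b - 1) * \<kappa>) \<le> ln Y / b"
    using heat_exp_interpolation [OF t L LB \<nu> \<kappa> b] by (simp add: H1 Hb X_def Y_def)
  have "exp (- (\<bar>b\<bar> * B)) \<le> Y"
    unfolding Y_def Hb [symmetric]
  proof (rule \<nu>.integral_ge_const)
    show "integrable \<nu> (heat_exp t L b)"
    proof (rule \<nu>.integrable_const_bound [of _ "exp (\<bar>b\<bar> * B)"])
      show "AE x in \<nu>. norm (heat_exp t L b x) \<le> exp (\<bar>b\<bar> * B)"
        using heat_exp_bounds(2) [OF t L LB] heat_exp_pos [OF t L LB] by (auto simp: less_imp_le)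
      show "heat_exp t L b \<in> borel_measurable \<nu>"
        unfolding heat_exp_def [OF t L LB, abs_def] measurable_cong_sets [OF \<nu>(2) refl] by measurable
    qed
    show "AE x in \<nu>. exp (- (\<bar>b\<bar> * B)) \<le> heat_exp t L b x"
      using heat_exp_bounds(1) [OF t L LB] by auto
  qed
  then have Y: "0 < Y" using exp_gt_zero less_le_trans by blast
  have X: "0 \<le> X" by (simp add: X_def)
  show ?thesis
    unfolding X_def [symmetric] Y_def [symmetric]
    using X Y le by (cases "X = 0") (auto simp: powr_def)
qed

text \<open>
  The lower bound on \<open>g\<close> is removed by adding small positive constants: the left-hand side
  only grows, and the right-hand side converges by bounded convergence.
\<close>
lemma heat_hypercontractive:
  fixes g :: "real ^ 'n \<Rightarrow> real"
  assumes \<nu>: "prob_space \<nu>" "sets \<nu> = sets borel" "log_sobolev \<nu> C"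
    and t: "0 < t" and \<kappa>: "0 \<le> \<kappa>" "\<kappa> * C \<le> t" and b: "1 \<le> b"
    and g [measurable]: "g \<in> borel_measurable borel" and gM: "\<And>z. 0 \<le> g z" "\<And>z. g z \<le> M"
  shows "(\<integral>x. (\<integral>z. g z \<partial>gauss_at t x) powr (b + (b - 1) * \<kappa>) \<partial>\<nu>) powr (1 / (b + (b - 1) * \<kappa>))
    \<le> (\<integral>x. \<integral>z. g z powr b \<partial>gauss_at t x \<partial>\<nu>) powr (1 / b)"
proof -
  interpret \<nu>: prob_space \<nu> by fact
  define a where "a = b + (b - 1) * \<kappa>"
  have a: "1 \<le> a" using b \<kappa> by (simp add: a_def add_increasing2)
  define \<delta> where "\<delta> n = 1 / real (Suc n)" for n
  have \<delta>: "0 < \<delta> n" "\<delta> n \<le> 1" for n by (auto simp: \<delta>_def)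
  have \<delta>lim: "\<delta> \<longlonglongrightarrow> 0" unfolding \<delta>_def by (rule LIMSEQ_Suc [OF lim_1_over_n])
  have M: "0 \<le> M" using gM [of 0] by linarith
  have meas_\<nu>: "f \<in> borel_measurable borel \<Longrightarrow> f \<in> borel_measurable \<nu>" for f :: "real ^ 'n \<Rightarrow> real"
    by (simp add: measurable_cong_sets [OF \<nu>(2) refl])
  have bound: "(g z + \<delta> n) powr b \<le> (M + 1) powr b" for z n
    using gM [of z] \<delta> [of n] b by (intro powr_mono2) auto
  have int_g: "integrable (gauss_at t x) g" "integrable (gauss_at t x) (\<lambda>z. g z + \<delta> n)"
    "integrable (gauss_at t x) (\<lambda>z. (g z + \<delta> n) powr b)" for x n
  proof -
    interpret N: prob_space "gauss_at t x" by (rule prob_space_gauss_at [OF t])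
    show "integrable (gauss_at t x) g"
      by (rule N.integrable_const_bound [of _ M]) (use gM in auto)
    then show "integrable (gauss_at t x) (\<lambda>z. g z + \<delta> n)" by simp
    show "integrable (gauss_at t x) (\<lambda>z. (g z + \<delta> n) powr b)"
      by (rule N.integrable_const_bound [of _ "(M + 1) powr b"]) (use bound in auto)
  qed
  have inner_bound: "0 \<le> (\<integral>z. g z + \<delta> n \<partial>gauss_at t x)" "(\<integral>z. g z + \<delta> n \<partial>gauss_at t x) \<le> M + 1"
    "(\<integral>z. (g z + \<delta> n) powr b \<partial>gauss_at t x) \<le> (M + 1) powr b"
    "(\<integral>z. g z \<partial>gauss_at t x) \<le> (\<integral>z. g z + \<delta> n \<partial>gauss_at t x)"
    "(\<integral>z. g z \<partial>gauss_at t x) \<le> M" for x n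
  proof -
    interpret N: prob_space "gauss_at t x" by (rule prob_space_gauss_at [OF t])
    show "0 \<le> (\<integral>z. g z + \<delta> n \<partial>gauss_at t x)"
      using gM \<delta> by (intro Bochner_Integration.integral_nonneg add_nonneg_nonneg) (auto simp: less_imp_le)
    show "(\<integral>z. g z + \<delta> n \<partial>gauss_at t x) \<le> M + 1"
      using gM \<delta> by (intro N.integral_le_const int_g AE_I2 add_mono)
    show "(\<integral>z. (g z + \<delta> n) powr b \<partial>gauss_at t x) \<le> (M + 1) powr b"
      using bound by (intro N.integral_le_const int_g AE_I2)
    show "(\<integral>z. g z \<partial>gauss_at t x) \<le> (\<integral>z. g z + \<delta> n \<partial>gauss_at t x)"
      using \<delta> by (intro integral_mono int_g) (auto simp: less_imp_le)
    show "(\<integral>z. g z \<partial>gauss_at t x) \<le> M"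
      using gM by (intro N.integral_le_const int_g AE_I2)
  qed
  have "(\<integral>x. (\<integral>z. g z \<partial>gauss_at t x) powr a \<partial>\<nu>) powr (1 / a)
      \<le> (\<integral>x. \<integral>z. (g z + \<delta> n) powr b \<partial>gauss_at t x \<partial>\<nu>) powr (1 / b)" for n
  proof -
    have "(\<integral>x. (\<integral>z. g z \<partial>gauss_at t x) powr a \<partial>\<nu>) \<le> (\<integral>x. (\<integral>z. g z + \<delta> n \<partial>gauss_at t x) powr a \<partial>\<nu>)"
    proof (rule integral_mono)
      show "integrable \<nu> (\<lambda>x. (\<integral>z. g z \<partial>gauss_at t x) powr a)"
      proof (rule \<nu>.integrable_const_bound [of _ "M powr a"])
        show "AE x in \<nu>. norm ((\<integral>z. g z \<partial>gauss_at t x) powr a) \<le> M powr a"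
          using inner_bound gM a by (auto intro!: AE_I2 powr_mono2)
      qed (rule meas_\<nu>, measurable)
      show "integrable \<nu> (\<lambda>x. (\<integral>z. g z + \<delta> n \<partial>gauss_at t x) powr a)"
      proof (rule \<nu>.integrable_const_bound [of _ "(M + 1) powr a"])
        show "AE x in \<nu>. norm ((\<integral>z. g z + \<delta> n \<partial>gauss_at t x) powr a) \<le> (M + 1) powr a"
          unfolding real_norm_def abs_of_nonneg [OF powr_ge_zero]
          using inner_bound a by (intro AE_I2 powr_mono2) auto
      qed (rule meas_\<nu>, measurable)
      show "(\<integral>z. g z \<partial>gauss_at t x) powr a \<le> (\<integral>z. g z + \<delta> n \<partial>gauss_at t x) powr a" for x
        using inner_bound gM a by (intro powr_mono2) auto
    qed
    then have "(\<integral>x. (\<integral>z. g z \<partial>gauss_at t x) powr a \<partial>\<nu>) powr (1 / a)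
        \<le> (\<integral>x. (\<integral>z. g z + \<delta> n \<partial>gauss_at t x) powr a \<partial>\<nu>) powr (1 / a)"
      using a by (intro powr_mono2) auto
    also have "\<dots> \<le> (\<integral>x. \<integral>z. (g z + \<delta> n) powr b \<partial>gauss_at t x \<partial>\<nu>) powr (1 / b)"
      unfolding a_def
      by (rule heat_hypercontractive_pos [OF \<nu> t \<kappa> b _ \<delta>(1) [of n], where M = "M + 1"])
        (use gM \<delta> in \<open>auto intro: add_mono\<close>)
    finally show ?thesis .
  qed
  moreover have "(\<lambda>n. (\<integral>x. \<integral>z. (g z + \<delta> n) powr b \<partial>gauss_at t x \<partial>\<nu>) powr (1 / b))
      \<longlonglongrightarrow> (\<integral>x. \<integral>z. g z powr b \<partial>gauss_at t x \<partial>\<nu>) powr (1 / b)"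
  proof (rule tendsto_powr2)
    show "(\<lambda>n. \<integral>x. \<integral>z. (g z + \<delta> n) powr b \<partial>gauss_at t x \<partial>\<nu>)
        \<longlonglongrightarrow> (\<integral>x. \<integral>z. g z powr b \<partial>gauss_at t x \<partial>\<nu>)"
    proof (rule integral_dominated_convergence [where w = "\<lambda>_. (M + 1) powr b"])
      show "AE x in \<nu>. (\<lambda>n. \<integral>z. (g z + \<delta> n) powr b \<partial>gauss_at t x) \<longlonglongrightarrow> (\<integral>z. g z powr b \<partial>gauss_at t x)"
      proof (rule AE_I2)
        fix x :: "real ^ 'n"
        interpret N: prob_space "gauss_at t x" by (rule prob_space_gauss_at [OF t])
        show "(\<lambda>n. \<integral>z. (g z + \<delta> n) powr b \<partial>gauss_at t x) \<longlonglongrightarrow> (\<integral>z. g z powr b \<partial>gauss_at t x)"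
        proof (rule integral_dominated_convergence [where w = "\<lambda>_. (M + 1) powr b"])
          have "(\<lambda>n. (g z + \<delta> n) powr b) \<longlonglongrightarrow> (g z + 0) powr b" for z
            using gM \<delta> b \<delta>lim
            by (intro tendsto_powr2 tendsto_add) (auto simp: add_nonneg_nonneg less_imp_le)
          then show "AE z in gauss_at t x. (\<lambda>n. (g z + \<delta> n) powr b) \<longlonglongrightarrow> g z powr b"
            by simp
          show "AE z in gauss_at t x. norm ((g z + \<delta> n) powr b) \<le> (M + 1) powr b" for n
            using bound by simp
        qed auto
      qed
      show "AE x in \<nu>. norm (\<integral>z. (g z + \<delta> n) powr b \<partial>gauss_at t x) \<le> (M + 1) powr b" for n
        using inner_bound by simp
      show "(\<lambda>x. \<integral>z. g z powr b \<partial>gauss_at t x) \<in> borel_measurable \<nu>"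
        by (rule meas_\<nu>) measurable
      show "(\<lambda>x. \<integral>z. (g z + \<delta> n) powr b \<partial>gauss_at t x) \<in> borel_measurable \<nu>" for n
        by (rule meas_\<nu>) measurable
    qed auto
  qed (use b in auto)
  ultimately show ?thesis
    unfolding a_def [symmetric] by (intro LIMSEQ_le_const) auto
qed

section \<open>Duality\<close>

text \<open>
  Young's inequality for \<open>F\<close> and \<open>G\<close> divided by their norms.
\<close>
lemma Hoelder_inequality:
  fixes F G :: "'a \<Rightarrow> real"
  assumes pa: "1 < p" "1 < a" "1 / p + 1 / a = 1"
    and nonneg: "\<And>x. 0 \<le> F x" "\<And>x. 0 \<le> G x"
    and [measurable]: "F \<in> borel_measurable M" "G \<in> borel_measurable M"
    and int: "integrable M (\<lambda>x. F x powr p)" "integrable M (\<lambda>x. G x powr a)"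
  shows "integrable M (\<lambda>x. F x * G x)"
    and "(\<integral>x. F x * G x \<partial>M) \<le> (\<integral>x. F x powr p \<partial>M) powr (1 / p) * (\<integral>x. G x powr a \<partial>M) powr (1 / a)"
proof -
  have young: "F x * G x \<le> F x powr p / p + G x powr a / a" for x
    by (rule Youngs_inequality [OF pa nonneg])
  show i: "integrable M (\<lambda>x. F x * G x)"
  proof (rule Bochner_Integration.integrable_bound)
    show "integrable M (\<lambda>x. F x powr p / p + G x powr a / a)" using int by auto
    show "AE x in M. norm (F x * G x) \<le> norm (F x powr p / p + G x powr a / a)"
      using young nonneg pa by (auto intro!: AE_I2 order_trans [OF young] simp: abs_mult)
  qed auto
  define A where "A = (\<integral>x. F x powr p \<partial>M)"
  define B where "B = (\<integral>x. G x powr a \<partial>M)"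
  have "0 \<le> A" "0 \<le> B" by (auto simp: A_def B_def)
  consider "A = 0" | "B = 0" | "0 < A" "0 < B"
    using \<open>0 \<le> A\<close> \<open>0 \<le> B\<close> by linarith
  then show "(\<integral>x. F x * G x \<partial>M) \<le> A powr (1 / p) * B powr (1 / a)"
  proof cases
    case 1
    then have "AE x in M. F x powr p = 0"
      using int unfolding A_def by (subst (asm) integral_nonneg_eq_0_iff_AE) auto
    then have "(\<integral>x. F x * G x \<partial>M) = 0"
      by (intro integral_eq_zero_AE) auto
    then show ?thesis by simp
  next
    case 2
    then have "AE x in M. G x powr a = 0"
      using int unfolding B_def by (subst (asm) integral_nonneg_eq_0_iff_AE) auto
    then have "(\<integral>x. F x * G x \<partial>M) = 0"
      by (intro integral_eq_zero_AE) auto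
    then show ?thesis by simp
  next
    case 3
    define c where "c = A powr (1 / p)"
    define d where "d = B powr (1 / a)"
    have cd: "0 < c" "0 < d" using 3 by (auto simp: c_def d_def)
    have c: "c powr p = A" and d: "d powr a = B"
      using 3 pa by (auto simp: c_def d_def powr_powr)
    have "F x / c * (G x / d) \<le> F x powr p / A / p + G x powr a / B / a" for x
      using Youngs_inequality [OF pa, of "F x / c" "G x / d"] nonneg [of x] cd
      by (simp add: powr_divide c d)
    then have "(\<integral>x. F x / c * (G x / d) \<partial>M) \<le> (\<integral>x. F x powr p / A / p + G x powr a / B / a \<partial>M)"
      using i int by (intro integral_mono) auto
    also have "\<dots> = 1 / p + 1 / a"
      using int 3 by (simp flip: A_def B_def)
    finally have "(\<integral>x. F x * G x \<partial>M) / (c * d) \<le> 1"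
      using pa by simp
    then show ?thesis
      using cd by (simp add: divide_le_eq flip: c_def d_def)
  qed
qed

lemma in_Lp_prob_space_integrable:
  assumes "prob_space M" "1 \<le> p" "in_Lp p M f"
  shows "integrable M f"
proof -
  interpret prob_space M by fact
  have [measurable]: "f \<in> borel_measurable M" and i: "integrable M (\<lambda>x. \<bar>f x\<bar> powr p)"
    using assms(3) by (auto simp: in_Lp_def)
  have le: "\<bar>f x\<bar> \<le> 1 + \<bar>f x\<bar> powr p" for x
  proof (cases "\<bar>f x\<bar> \<le> 1")
    case True
    then show ?thesis by (simp add: add_increasing2)
  next
    case False
    then have "\<bar>f x\<bar> powr 1 \<le> \<bar>f x\<bar> powr p"
      using assms(2) by (intro powr_mono) auto
    then show ?thesis by simp
  qed
  show ?thesis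
    by (rule Bochner_Integration.integrable_bound [of _ "\<lambda>x. 1 + \<bar>f x\<bar> powr p"]) (use i le in auto)
qed

lemma heat_adjoint_measurable [measurable]:
  assumes "prob_space \<nu>" and [measurable_cong]: "sets \<nu> = sets borel"
    and [measurable]: "f \<in> borel_measurable borel"
  shows "heat_adjoint \<nu> t f \<in> borel_measurable borel"
proof -
  interpret prob_space \<nu> by fact
  show ?thesis
  proof (cases "t = 0")
    case True
    then show ?thesis using assms(3) by (simp add: heat_adjoint_def [abs_def])
  next
    case False
    have "(\<lambda>y. (\<integral>x. f x * gauss_density t (y - x) \<partial>\<nu>) / (\<integral>x. gauss_density t (y - x) \<partial>\<nu>)) \<in> borel_measurable borel"
      by measurable
    with False show ?thesis by (simp add: heat_adjoint_def [abs_def])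
  qed
qed

text \<open>
  Tonelli's theorem: the denominator in the definition of the adjoint is the Lebesgue density
  of \<open>\<nu> * \<gamma>_t\<close>, so it cancels. Both sides are integrals in \<open>[0, \<infinity>]\<close>, so
  that the identity precedes any knowledge about the integrability of the adjoint.
\<close>
lemma heat_adjoint_duality:
  fixes F g :: "real ^ 'n \<Rightarrow> real"
  assumes "prob_space \<nu>" and [measurable_cong]: "sets \<nu> = sets borel" and t: "0 < t"
    and F: "integrable \<nu> F" "\<And>x. 0 \<le> F x" and g [measurable]: "g \<in> borel_measurable borel"
    and g0: "\<And>x. 0 \<le> g x"
  shows "(\<integral>\<^sup>+x. \<integral>\<^sup>+z. heat_adjoint \<nu> t F z * g z \<partial>gauss_at t x \<partial>\<nu>) = (\<integral>\<^sup>+x. F x * (\<integral>\<^sup>+z. g z \<partial>gauss_at t x) \<partial>\<nu>)"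
proof -
  interpret \<nu>: prob_space \<nu> by fact
  interpret P: pair_sigma_finite \<nu> "lborel :: (real ^ 'n) measure" ..
  have F_borel [measurable]: "F \<in> borel_measurable borel"
    using F(1) assms(2) by (simp add: borel_measurable_integrable flip: measurable_cong_sets [OF assms(2) refl])
  define W where "W = heat_adjoint \<nu> t F"
  have [measurable]: "W \<in> borel_measurable borel"
    unfolding W_def by (rule heat_adjoint_measurable [OF assms(1,2) F_borel])
  have g1: "integrable \<nu> (\<lambda>x. gauss_density t (z - x))" for z
    by (rule \<nu>.integrable_const_bound [of _ "gauss_density t (0 :: real ^ 'n)"]) (auto simp: gauss_density_le [OF t])
  have g2: "integrable \<nu> (\<lambda>x. F x * gauss_density t (z - x))" for z
    by (rule Bochner_Integration.integrable_bound [OF integrable_mult_left [OF F(1), of "gauss_density t (0 :: real ^ 'n)"]])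
      (auto simp: abs_mult gauss_density_le [OF t] intro!: mult_left_mono)
  have pos: "0 < (\<integral>x. gauss_density t (z - x) \<partial>\<nu>)" for z
  proof (rule ccontr)
    assume "\<not> ?thesis"
    moreover have "0 \<le> (\<integral>x. gauss_density t (z - x) \<partial>\<nu>)" by simp
    ultimately have "(\<integral>x. gauss_density t (z - x) \<partial>\<nu>) = 0" by linarith
    then have "AE x in \<nu>. gauss_density t (z - x) = 0"
      using g1 by (subst (asm) integral_nonneg_eq_0_iff_AE) auto
    moreover have "gauss_density t (z - x) \<noteq> 0" for x
      using gauss_density_pos [OF t, of "z - x"] by simp
    ultimately show False by simp
  qed
  have W0: "0 \<le> W z" for z
    using t F(2) by (simp add: W_def heat_adjoint_def)
  have W: "W z * (\<integral>x. gauss_density t (z - x) \<partial>\<nu>) = (\<integral>x. F x * gauss_density t (z - x) \<partial>\<nu>)" for z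
    using t pos [of z] by (simp add: W_def heat_adjoint_def)
  have "(\<integral>\<^sup>+x. \<integral>\<^sup>+z. W z * g z \<partial>gauss_at t x \<partial>\<nu>)
      = (\<integral>\<^sup>+x. \<integral>\<^sup>+z. ennreal (W z * g z) * ennreal (gauss_density t (z - x)) \<partial>lborel \<partial>\<nu>)"
    by (simp add: gauss_at_def nn_integral_density mult.commute)
  also have "\<dots> = (\<integral>\<^sup>+z. \<integral>\<^sup>+x. ennreal (W z * g z) * ennreal (gauss_density t (z - x)) \<partial>\<nu> \<partial>lborel)"
    by (rule P.Fubini' [symmetric]) measurable
  also have "\<dots> = (\<integral>\<^sup>+z. \<integral>\<^sup>+x. ennreal (F x) * (ennreal (gauss_density t (z - x)) * ennreal (g z)) \<partial>\<nu> \<partial>lborel)"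
  proof (rule nn_integral_cong)
    fix z :: "real ^ 'n"
    have "(\<integral>\<^sup>+x. ennreal (W z * g z) * ennreal (gauss_density t (z - x)) \<partial>\<nu>)
        = ennreal (W z * g z) * ennreal (\<integral>x. gauss_density t (z - x) \<partial>\<nu>)"
      using g1 by (subst nn_integral_cmult) (auto simp: nn_integral_eq_integral)
    also have "\<dots> = ennreal (g z) * ennreal (\<integral>x. F x * gauss_density t (z - x) \<partial>\<nu>)"
      using W0 [of z] g0 [of z] by (simp add: W [symmetric] mult_ac flip: ennreal_mult)
    also have "ennreal (\<integral>x. F x * gauss_density t (z - x) \<partial>\<nu>) = (\<integral>\<^sup>+x. ennreal (F x * gauss_density t (z - x)) \<partial>\<nu>)"
      using g2 F(2) by (intro nn_integral_eq_integral [symmetric]) auto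
    also have "ennreal (g z) * \<dots> = (\<integral>\<^sup>+x. ennreal (g z) * ennreal (F x * gauss_density t (z - x)) \<partial>\<nu>)"
      by (rule nn_integral_cmult [symmetric]) measurable
    also have "\<dots> = (\<integral>\<^sup>+x. ennreal (F x) * (ennreal (gauss_density t (z - x)) * ennreal (g z)) \<partial>\<nu>)"
      using F(2) by (simp add: ennreal_mult mult_ac)
    finally show "(\<integral>\<^sup>+x. ennreal (W z * g z) * ennreal (gauss_density t (z - x)) \<partial>\<nu>)
        = (\<integral>\<^sup>+x. ennreal (F x) * (ennreal (gauss_density t (z - x)) * ennreal (g z)) \<partial>\<nu>)" .
  qed
  also have "\<dots> = (\<integral>\<^sup>+x. \<integral>\<^sup>+z. ennreal (F x) * (ennreal (gauss_density t (z - x)) * ennreal (g z)) \<partial>lborel \<partial>\<nu>)"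
    by (rule P.Fubini') measurable
  also have "\<dots> = (\<integral>\<^sup>+x. F x * (\<integral>\<^sup>+z. g z \<partial>gauss_at t x) \<partial>\<nu>)"
    by (simp add: gauss_at_def nn_integral_density nn_integral_cmult)
  finally show ?thesis by (simp add: W_def)
qed

text \<open>
  Let \<open>W = Q_t F\<close>, \<open>h = min W n\<close> and \<open>J = \<integral> h^q d\<nu>_t\<close>. Testing against \<open>g = h^(q - 1)\<close>
  gives \<open>J \<le> \<integral> W g d\<nu>_t = \<integral> F P_t g d\<nu>\<close>. Hoelder's inequality and hypercontractivity bound this
  by the norm of \<open>F\<close> times \<open>J^(1/b)\<close>, because \<open>g^b = h^q\<close>. The truncation keeps \<open>J\<close> finite,
  so \<open>J^(1/b)\<close> can be cancelled.
\<close>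
lemma heat_adjoint_nonneg_bound:
  fixes F :: "real ^ 'n \<Rightarrow> real"
  assumes \<nu>: "prob_space \<nu>" "sets \<nu> = sets borel" "log_sobolev \<nu> C"
    and t: "0 < t" and \<kappa>: "0 \<le> \<kappa>" "\<kappa> * C \<le> t" and p: "1 < p"
    and F: "in_Lp p \<nu> F" "\<And>x. 0 \<le> F x"
    and q: "q = 1 + (p - 1) * (1 + \<kappa>)"
  shows "(\<integral>\<^sup>+y. heat_adjoint \<nu> t F y powr q \<partial>(\<nu> \<star> gauss t)) \<le> ennreal (Lp_norm p \<nu> F powr q)"
proof -
  interpret \<nu>: prob_space \<nu> by fact
  note [measurable_cong] = \<nu>(2)
  have F_borel [measurable]: "F \<in> borel_measurable borel"
    using F(1) by (simp add: in_Lp_def measurable_cong_sets [OF \<nu>(2) refl])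
  have F_int: "integrable \<nu> F"
    using in_Lp_prob_space_integrable [OF \<nu>(1) _ F(1)] p by simp
  define W where "W = heat_adjoint \<nu> t F"
  have W_meas [measurable]: "W \<in> borel_measurable borel"
    unfolding W_def by (rule heat_adjoint_measurable [OF \<nu>(1,2) F_borel])
  have W0: "0 \<le> W z" for z
    using t F(2) by (simp add: W_def heat_adjoint_def)
  have q1: "1 < q" using p \<kappa> by (simp add: q add_pos_nonneg)
  define a where "a = p / (p - 1)"
  define b where "b = q / (q - 1)"
  have a: "1 < a" "1 / p + 1 / a = 1" and b: "1 < b" "(q - 1) * b = q" "1 / q + 1 / b = 1"
    using p q1 by (auto simp: a_def b_def field_simps)
  have ab: "b + (b - 1) * \<kappa> = a"
  proof -
    have "b + (b - 1) * \<kappa> = 1 + (1 + \<kappa>) / (q - 1)"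
    proof -
      have "b - 1 = 1 / (q - 1)" using q1 by (simp add: b_def field_simps)
      then show ?thesis by (simp add: algebra_simps add_divide_distrib)
    qed
    also have "(1 + \<kappa>) / (q - 1) = 1 / (p - 1)"
      using p \<kappa> by (simp add: q)
    also have "1 + 1 / (p - 1) = a"
      using p by (simp add: a_def field_simps)
    finally show ?thesis .
  qed
  define A where "A = Lp_norm p \<nu> F"
  have A: "A = (\<integral>x. F x powr p \<partial>\<nu>) powr (1 / p)"
    using F(2) by (simp add: A_def Lp_norm_def)
  have A0: "0 \<le> A" by (simp add: A)
  have trunc: "(\<integral>\<^sup>+y. min (W y) (real n) powr q \<partial>(\<nu> \<star> gauss t)) \<le> ennreal (A powr q)" for n
  proof -
    define h where "h y = min (W y) (real n)" for y
    define g where "g y = h y powr (q - 1)" for y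
    have h: "0 \<le> h y" "h y \<le> real n" "h y \<le> W y" for y using W0 by (auto simp: h_def)
    have h_meas [measurable]: "h \<in> borel_measurable borel" unfolding h_def by measurable
    have g_meas [measurable]: "g \<in> borel_measurable borel" unfolding g_def by measurable
    have g0: "0 \<le> g y" for y by (simp add: g_def)
    have gM: "g y \<le> real n powr (q - 1)" for y
      unfolding g_def using h q1 by (intro powr_mono2) auto
    have gb: "g y powr b = h y powr q" for y
      by (simp add: g_def powr_powr b)
    have hM: "h y powr q \<le> real n powr q" for y
      using h q1 by (intro powr_mono2) auto
    define J where "J = (\<integral>x. \<integral>z. h z powr q \<partial>gauss_at t x \<partial>\<nu>)"
    define Pg where "Pg x = (\<integral>z. g z \<partial>gauss_at t x)" for x
    have meas: "(\<lambda>x. \<integral>z. h z powr q \<partial>gauss_at t x) \<in> borel_measurable borel" "Pg \<in> borel_measurable borel"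
      unfolding Pg_def by measurable
    then have meas_\<nu> [measurable]:
      "(\<lambda>x. \<integral>z. h z powr q \<partial>gauss_at t x) \<in> borel_measurable \<nu>" "Pg \<in> borel_measurable \<nu>"
      by (simp_all add: measurable_cong_sets [OF \<nu>(2) refl])
    have inner: "(\<integral>\<^sup>+z. ennreal (h z powr q) \<partial>gauss_at t x) = ennreal (\<integral>z. h z powr q \<partial>gauss_at t x)"
      "(\<integral>z. h z powr q \<partial>gauss_at t x) \<le> real n powr q"
      "(\<integral>\<^sup>+z. ennreal (g z) \<partial>gauss_at t x) = ennreal (Pg x)"
      "Pg x \<le> real n powr (q - 1)" "0 \<le> Pg x" for x
    proof -
      interpret N: prob_space "gauss_at t x" by (rule prob_space_gauss_at [OF t])
      have i1: "integrable (gauss_at t x) (\<lambda>z. h z powr q)"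
        by (rule N.integrable_const_bound [of _ "real n powr q"]) (use hM in auto)
      have i2: "integrable (gauss_at t x) g"
        by (rule N.integrable_const_bound [of _ "real n powr (q - 1)"]) (use gM g0 in auto)
      show "(\<integral>\<^sup>+z. ennreal (h z powr q) \<partial>gauss_at t x) = ennreal (\<integral>z. h z powr q \<partial>gauss_at t x)"
        using i1 by (rule nn_integral_eq_integral) simp
      show "(\<integral>\<^sup>+z. ennreal (g z) \<partial>gauss_at t x) = ennreal (Pg x)"
        unfolding Pg_def using i2 g0 by (intro nn_integral_eq_integral) auto
      show "(\<integral>z. h z powr q \<partial>gauss_at t x) \<le> real n powr q"
        using hM by (intro N.integral_le_const [OF i1]) auto
      show "Pg x \<le> real n powr (q - 1)" "0 \<le> Pg x"
        unfolding Pg_def using gM g0 by (auto intro!: N.integral_le_const [OF i2])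
    qed
    have J_eq: "(\<integral>\<^sup>+x. \<integral>\<^sup>+z. ennreal (h z powr q) \<partial>gauss_at t x \<partial>\<nu>) = ennreal J"
      unfolding inner J_def
    proof (rule nn_integral_eq_integral)
      show "integrable \<nu> (\<lambda>x. \<integral>z. h z powr q \<partial>gauss_at t x)"
        by (rule \<nu>.integrable_const_bound [of _ "real n powr q"]) (use inner in auto)
    qed auto
    have Hoelder: "integrable \<nu> (\<lambda>x. F x * Pg x)"
      "(\<integral>x. F x * Pg x \<partial>\<nu>) \<le> A * (\<integral>x. Pg x powr a \<partial>\<nu>) powr (1 / a)"
    proof -
      have 1: "integrable \<nu> (\<lambda>x. F x powr p)" using F by (simp add: in_Lp_def)
      have 2: "integrable \<nu> (\<lambda>x. Pg x powr a)"
      proof (rule \<nu>.integrable_const_bound [of _ "(real n powr (q - 1)) powr a"])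
        show "AE x in \<nu>. norm (Pg x powr a) \<le> (real n powr (q - 1)) powr a"
          unfolding real_norm_def abs_of_nonneg [OF powr_ge_zero]
          using inner a by (intro AE_I2 powr_mono2) auto
      qed measurable
      show "integrable \<nu> (\<lambda>x. F x * Pg x)"
        by (rule Hoelder_inequality(1) [OF p a F(2) inner(5) _ _ 1 2]) auto
      show "(\<integral>x. F x * Pg x \<partial>\<nu>) \<le> A * (\<integral>x. Pg x powr a \<partial>\<nu>) powr (1 / a)"
        unfolding A by (rule Hoelder_inequality(2) [OF p a F(2) inner(5) _ _ 1 2]) auto
    qed
    have "ennreal J \<le> (\<integral>\<^sup>+x. \<integral>\<^sup>+z. ennreal (W z * g z) \<partial>gauss_at t x \<partial>\<nu>)"
      unfolding J_eq [symmetric]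
    proof (intro nn_integral_mono ennreal_leI)
      fix z
      have "h z powr q = h z * h z powr (q - 1)"
        using h(1) [of z] powr_add [of "h z" 1 "q - 1"] by (cases "h z = 0") auto
      also have "\<dots> \<le> W z * g z"
        unfolding g_def using h(3) [of z] by (intro mult_right_mono) auto
      finally show "h z powr q \<le> W z * g z" .
    qed
    also have "\<dots> = (\<integral>\<^sup>+x. ennreal (F x) * (\<integral>\<^sup>+z. g z \<partial>gauss_at t x) \<partial>\<nu>)"
      unfolding W_def by (rule heat_adjoint_duality [OF \<nu>(1,2) t F_int F(2) g_meas g0])
    also have "\<dots> = (\<integral>\<^sup>+x. ennreal (F x * Pg x) \<partial>\<nu>)"
      using F(2) inner by (simp add: ennreal_mult)
    also have "\<dots> = ennreal (\<integral>x. F x * Pg x \<partial>\<nu>)"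
      using Hoelder(1) F(2) inner by (intro nn_integral_eq_integral) auto
    finally have "J \<le> (\<integral>x. F x * Pg x \<partial>\<nu>)"
      using F(2) inner by (subst (asm) ennreal_le_iff) auto
    also have "\<dots> \<le> A * (\<integral>x. Pg x powr a \<partial>\<nu>) powr (1 / a)"
      by (rule Hoelder(2))
    also have "\<dots> \<le> A * J powr (1 / b)"
      using heat_hypercontractive [OF \<nu> t \<kappa> less_imp_le [OF b(1)] g_meas g0 gM] A0
      by (intro mult_left_mono) (auto simp: ab gb J_def Pg_def)
    finally have J: "J \<le> A * J powr (1 / b)" .
    have "0 \<le> J" unfolding J_def by simp
    have "J \<le> A powr q"
    proof (cases "J = 0")
      case False
      with \<open>0 \<le> J\<close> have "0 < J" by simp
      have "J powr (1 / q) * J powr (1 / b) = J"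
        using \<open>0 < J\<close> b(3) by (simp flip: powr_add)
      with J have "J powr (1 / q) * J powr (1 / b) \<le> A * J powr (1 / b)" by simp
      then have "J powr (1 / q) \<le> A"
        using \<open>0 < J\<close> by (subst (asm) mult_le_cancel_right_pos) auto
      then have "(J powr (1 / q)) powr q \<le> A powr q"
        using q1 by (intro powr_mono2) auto
      then show ?thesis using \<open>0 < J\<close> q1 by (simp add: powr_powr)
    qed simp
    moreover have "(\<integral>\<^sup>+y. h y powr q \<partial>(\<nu> \<star> gauss t)) = ennreal J"
      unfolding J_eq [symmetric] by (rule nn_integral_convolution_gauss [OF \<nu>(1,2) t]) measurable
    ultimately show ?thesis
      by (simp add: h_def ennreal_leI)
  qed
  have "(\<integral>\<^sup>+y. W y powr q \<partial>(\<nu> \<star> gauss t)) \<le> (\<integral>\<^sup>+y. (SUP n. ennreal (min (W y) (real n) powr q)) \<partial>(\<nu> \<star> gauss t))"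
  proof (rule nn_integral_mono)
    fix y
    obtain n where "W y \<le> real n" using real_arch_simple by blast
    then show "ennreal (W y powr q) \<le> (SUP n. ennreal (min (W y) (real n) powr q))"
      by (intro SUP_upper2 [of n]) auto
  qed
  also have "\<dots> = (SUP n. \<integral>\<^sup>+y. min (W y) (real n) powr q \<partial>(\<nu> \<star> gauss t))"
  proof (rule nn_integral_monotone_convergence_SUP)
    show "incseq (\<lambda>n y. ennreal (min (W y) (real n) powr q))"
      using W0 q1 by (auto simp: incseq_def le_fun_def intro!: ennreal_leI powr_mono2)
    show "(\<lambda>y. ennreal (min (W y) (real n) powr q)) \<in> borel_measurable (\<nu> \<star> gauss t)" for n
      unfolding measurable_convolution2 by measurable
  qed
  also have "\<dots> \<le> ennreal (A powr q)"
    using trunc by (intro SUP_least)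
  finally show ?thesis
    by (simp add: W_def A_def)
qed

text \<open>
  The pointwise bound \<open>|Q_t f| \<le> Q_t |f|\<close> reduces the claim to nonnegative functions.
\<close>
lemma heat_adjoint_Lp_bound:
  fixes f :: "real ^ 'n \<Rightarrow> real"
  assumes \<nu>: "prob_space \<nu>" "sets \<nu> = sets borel" "log_sobolev \<nu> C"
    and t: "0 < t" and \<kappa>: "0 \<le> \<kappa>" "\<kappa> * C \<le> t" and p: "1 < p"
    and f: "in_Lp p \<nu> f" and q: "q = 1 + (p - 1) * (1 + \<kappa>)"
  shows "in_Lp q (\<nu> \<star> gauss t) (heat_adjoint \<nu> t f) \<and>
    Lp_norm q (\<nu> \<star> gauss t) (heat_adjoint \<nu> t f) \<le> Lp_norm p \<nu> f"
proof -
  interpret \<nu>: prob_space \<nu> by fact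
  have f_borel [measurable]: "f \<in> borel_measurable borel"
    using f by (simp add: in_Lp_def measurable_cong_sets [OF \<nu>(2) refl])
  have q1: "1 < q" using p \<kappa> by (simp add: q add_pos_nonneg)
  have meas [measurable]: "heat_adjoint \<nu> t f \<in> borel_measurable borel"
    by (rule heat_adjoint_measurable [OF \<nu>(1,2) f_borel])
  define A where "A = Lp_norm p \<nu> f"
  have A0: "0 \<le> A" by (simp add: A_def Lp_norm_def)
  have abs_f: "in_Lp p \<nu> (\<lambda>x. \<bar>f x\<bar>)" "Lp_norm p \<nu> (\<lambda>x. \<bar>f x\<bar>) = A"
    using f by (auto simp: in_Lp_def A_def Lp_norm_def)
  have "\<bar>heat_adjoint \<nu> t f y\<bar> \<le> heat_adjoint \<nu> t (\<lambda>x. \<bar>f x\<bar>) y" for y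
  proof -
    have "\<bar>\<integral>x. f x * gauss_density t (y - x) \<partial>\<nu>\<bar> \<le> (\<integral>x. \<bar>f x * gauss_density t (y - x)\<bar> \<partial>\<nu>)"
      by (rule integral_abs_bound)
    then show ?thesis
      using t by (simp add: heat_adjoint_def abs_divide abs_mult divide_right_mono)
  qed
  then have "(\<integral>\<^sup>+y. \<bar>heat_adjoint \<nu> t f y\<bar> powr q \<partial>(\<nu> \<star> gauss t))
      \<le> (\<integral>\<^sup>+y. heat_adjoint \<nu> t (\<lambda>x. \<bar>f x\<bar>) y powr q \<partial>(\<nu> \<star> gauss t))"
    using q1 by (intro nn_integral_mono ennreal_leI powr_mono2) auto
  also have "\<dots> \<le> ennreal (A powr q)"
    using heat_adjoint_nonneg_bound [OF \<nu> t \<kappa> p abs_f(1) _ q] by (simp add: abs_f)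
  finally have le: "(\<integral>\<^sup>+y. \<bar>heat_adjoint \<nu> t f y\<bar> powr q \<partial>(\<nu> \<star> gauss t)) \<le> ennreal (A powr q)" .
  have int: "integrable (\<nu> \<star> gauss t) (\<lambda>y. \<bar>heat_adjoint \<nu> t f y\<bar> powr q)"
    by (rule integrableI_bounded) (use le in \<open>auto intro: le_less_trans\<close>)
  have "ennreal (\<integral>y. \<bar>heat_adjoint \<nu> t f y\<bar> powr q \<partial>(\<nu> \<star> gauss t)) \<le> ennreal (A powr q)"
    using le nn_integral_eq_integral [OF int] by simp
  then have "(\<integral>y. \<bar>heat_adjoint \<nu> t f y\<bar> powr q \<partial>(\<nu> \<star> gauss t)) \<le> A powr q"
    by simp
  then have "Lp_norm q (\<nu> \<star> gauss t) (heat_adjoint \<nu> t f) \<le> (A powr q) powr (1 / q)"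
    unfolding Lp_norm_def using q1 by (intro powr_mono2) auto
  also have "\<dots> = A"
    using A0 q1 by (simp add: powr_powr)
  finally show ?thesis
    using int meas by (simp add: in_Lp_def A_def)
qed

lemma convolution_return_0:
  fixes \<nu> :: "'a :: ordered_euclidean_space measure"
  assumes "prob_space \<nu>" "sets \<nu> = sets borel"
  shows "\<nu> \<star> return borel 0 = \<nu>"
proof (rule measure_eqI)
  interpret \<nu>: prob_space \<nu> by fact
  interpret R: prob_space "return borel (0 :: 'a)" by (rule prob_space_return) simp
  fix X assume "X \<in> sets (\<nu> \<star> return borel 0)"
  then have X: "X \<in> sets borel" by simp
  have "emeasure (\<nu> \<star> return borel 0) X = (\<integral>\<^sup>+x. \<integral>\<^sup>+y. indicator X (x + y) \<partial>return borel 0 \<partial>\<nu>)"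
    using X assms(2) by (intro convolution_emeasure') (auto intro: \<nu>.finite_measure_axioms R.finite_measure_axioms)
  also have "\<dots> = (\<integral>\<^sup>+x. indicator X x \<partial>\<nu>)"
    using X by (intro nn_integral_cong) (subst nn_integral_return, auto)
  also have "\<dots> = emeasure \<nu> X"
    using X assms(2) by simp
  finally show "emeasure (\<nu> \<star> return borel 0) X = emeasure \<nu> X" .
qed (use assms in simp)

theorem theorem1p2:
  fixes \<nu> :: "(real ^ 'n) measure" and p t :: real and q :: "real \<Rightarrow> real"
    and f :: "real ^ 'n \<Rightarrow> real"
  assumes "prob_space \<nu>" and "sets \<nu> = sets borel"
    and "\<exists>C. log_sobolev \<nu> C"
    and "1 < p"
    and "\<And>s. 0 \<le> s \<Longrightarrow> (q s - 1) / (p - 1) = 1 + s / C_LSI \<nu>"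
    and "0 \<le> t"
    and "in_Lp p \<nu> f"
  shows "in_Lp (q t) (\<nu> \<star> gauss t) (heat_adjoint \<nu> t f) \<and>
    Lp_norm (q t) (\<nu> \<star> gauss t) (heat_adjoint \<nu> t f) \<le> Lp_norm p \<nu> f"
proof -
  have q: "q t = 1 + (p - 1) * (1 + t / C_LSI \<nu>)"
    using assms(5) [OF assms(6)] assms(4) by (simp add: field_simps)
  have lsi: "log_sobolev \<nu> (C_LSI \<nu>)"
    by (rule log_sobolev_C_LSI [OF assms(1-3)])
  have C: "0 \<le> C_LSI \<nu>"
    by (rule log_sobolev_constant_nonneg [OF assms(1,2) lsi])
  show ?thesis
  proof (cases "t = 0")
    case True
    then have "q t = p" "heat_adjoint \<nu> t f = f" "\<nu> \<star> gauss t = \<nu>"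
      using q convolution_return_0 [OF assms(1,2)] by (auto simp: heat_adjoint_def gauss_def)
    then show ?thesis using assms(7) by simp
  next
    case False
    then have t: "0 < t" using assms(6) by simp
    show ?thesis
    proof (rule heat_adjoint_Lp_bound [OF assms(1,2) lsi t _ _ assms(4) assms(7) q])
      \<comment> \<open>If \<open>C_LSI \<nu> = 0\<close>, as for a point mass, the quotient is \<open>0\<close> and \<open>q t = p\<close>.\<close>
      show "0 \<le> t / C_LSI \<nu>" "t / C_LSI \<nu> * C_LSI \<nu> \<le> t"
        using t C by (auto simp: divide_nonneg_nonneg)
    qed
  qed
qed

end
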